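(* Let $H$ be a group and let $\ell\colon H\to \mathbb N\cup\{0\}$ be a length function such that the growth of $H$ with respect to $\ell$ is at most exponential. Then $H$ embeds (as a subgroup) into a group $G$ generated by a finite set $X$ such that the following conditions hold. (a) There exists $c>0$ such that for every $h\in H$ we have $c|h|_X\le \ell(h)\le |h|_X$. (b) $G$ has a normal series $G_1\lhd G_2\lhd G$, where $G_1$ is abelian and intersects $H$ trivially, $G_2/G_1\in\mathcal E(H)$, and $G/G_2$ is solvable of derived length at most $3$.
   Context: A length function on a group $H$ is a map $\ell\colon H\to\mathbb N\cup\{0\}$ such that (L1) $\ell(h)=0$ iff $h=1$; (L2) $\ell(h)=\ell(h^{-1})$ for all $h\in H$; (L3) $\ell(gh)\le\ell(g)+\ell(h)$ for all $g,h\in H$. The growth of $H$ with respect to $\ell$ is at most exponential if there is a constant $a$ such that $\#\{h\in H\mid \ell(h)\le n\}\le a^n$ for every $n\in\mathbb N$. For a group $G$ generated by a set $X$ and $g\in G$, $|g|_X$ is the length of a shortest word in the alphabet $X\cup X^{-1}$ representing $g$. For a group $H$, $\mathcal E(H)$ denotes the class of all groups $K$ such that every finitely generated subgroup of $K$ embeds in a finite direct power of $H$. In a normal series $G_1\lhd G_2\lhd G$ each term is a normal subgroup of $G$. *)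

theory Defs
  imports Complex_Main "HOL-Algebra.Product_Groups" "HOL-Algebra.Solvable_Groups"
begin

definition length_function :: "('a, 'b) monoid_scheme \<Rightarrow> ('a \<Rightarrow> nat) \<Rightarrow> bool" where
  "length_function H l \<longleftrightarrow>
     (\<forall>h\<in>carrier H. l h = 0 \<longleftrightarrow> h = \<one>\<^bsub>H\<^esub>) \<and>
     (\<forall>h\<in>carrier H. l h = l (inv\<^bsub>H\<^esub> h)) \<and>
     (\<forall>g\<in>carrier H. \<forall>h\<in>carrier H. l (g \<otimes>\<^bsub>H\<^esub> h) \<le> l g + l h)"

text \<open>Finiteness of the balls has to be stated separately, since \<^const>\<open>card\<close> is \<open>0\<close> on
  infinite sets.\<close>

definition growth_at_most_exponential ::
    "('a, 'b) monoid_scheme \<Rightarrow> ('a \<Rightarrow> nat) \<Rightarrow> bool" where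
  "growth_at_most_exponential H l \<longleftrightarrow>
     (\<exists>a::real. \<forall>n\<ge>1. finite {h \<in> carrier H. l h \<le> n} \<and>
                       real (card {h \<in> carrier H. l h \<le> n}) \<le> a ^ n)"

text \<open>A word over \<open>S \<union> S\<inverse>\<close> is a list of elements of \<open>G\<close>, and the element it represents is
  the product of its letters. The value is meaningful only for \<open>g\<close> in the subgroup generated
  by \<open>S\<close>.\<close>

definition word_length :: "('a, 'b) monoid_scheme \<Rightarrow> 'a set \<Rightarrow> 'a \<Rightarrow> nat" where
  "word_length G S g =
     (LEAST n. \<exists>w. set w \<subseteq> S \<union> m_inv G ` S \<and> length w = n \<and>
                   foldr (\<otimes>\<^bsub>G\<^esub>) w \<one>\<^bsub>G\<^esub> = g)"

text \<open>The class \<open>\<E>(H)\<close>: the direct power \<open>H\<^sup>n\<close> is the product of copies of \<open>H\<close> indexed by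
  \<open>{..<n}\<close>, and \<^const>\<open>mon\<close> is the set of injective homomorphisms.\<close>

definition in_class_E :: "('a, 'b) monoid_scheme \<Rightarrow> ('c, 'd) monoid_scheme \<Rightarrow> bool" where
  "in_class_E H K \<longleftrightarrow>
     group K \<and>
     (\<forall>S. finite S \<and> S \<subseteq> carrier K \<longrightarrow>
        (\<exists>n::nat. mon (subgroup_generated K S) (product_group {..<n} (\<lambda>_. H)) \<noteq> {}))"

text \<open>Meaningful only for solvable groups.\<close>

definition derived_length :: "('a, 'b) monoid_scheme \<Rightarrow> nat" where
  "derived_length G = (LEAST n. (derived G ^^ n) (carrier G) = {\<one>\<^bsub>G\<^esub>})"

end

theory Submission
  imports "HOL-Computational_Algebra.Polynomial" "HOL-Library.Countable_Set" Defs
begin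

text \<open>Let \<open>P\<close> be the metabelian group of affine maps of \<open>\<complex>\<close> generated by \<open>q \<mapsto> 2 q\<close>, \<open>q \<mapsto> q + 1\<close>
  and \<open>q \<mapsto> q + \<i>\<close>. Binary expansion shows that \<open>P\<close> moves \<open>0\<close> to \<open>u + \<i> u\<^sup>2\<close> by a word of length
  \<open>O(log u)\<close>; since the growth is exponential, every \<open>h\<close> in \<open>H\<close> receives its own such point \<open>z h\<close>
  at distance \<open>O(l h)\<close>. Take \<open>H\<close>-valued functions on \<open>\<complex> \<times> \<int>\<close>, twisted by real cocycles. One
  generator has value \<open>h\<close> on the ray \<open>{(z h, n). n \<ge> 0}\<close>, another one contributes the coboundary
  of \<open>l\<close> at \<open>h\<close> divided by \<open>l h\<close>, and a third one shifts \<open>{0} \<times> \<int>\<close>. After moving \<open>z h\<close> to \<open>0\<close>,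
  the commutator with the shift isolates the point \<open>(0, 0)\<close>, so \<open>H\<close> embeds with word length
  \<open>O(l h)\<close>. Conversely every letter changes the cocycle by at most \<open>1\<close>, and the image of \<open>h\<close> has
  cocycle \<open>- l h\<close> at the identity, which bounds the word length from below.

  The pure cocycles form \<open>G1\<close>, and \<open>G2\<close> consists of the functions with finite support in \<open>\<complex>\<close>.
  A nontrivial affine map sends only finitely many points of the parabola to the parabola, so the
  conjugates of the nonaffine generators commute modulo \<open>G2\<close>, and \<open>G / G2\<close> is abelian by \<open>P\<close>.
  Along \<open>\<int>\<close> the functions are eventually constant, so finitely many elements of \<open>G2 / G1\<close> are
  determined by finitely many coordinates.\<close>

section \<open>Words and generated subgroups\<close>

definition word_over :: "('a, 'b) monoid_scheme \<Rightarrow> 'a set \<Rightarrow> 'a list \<Rightarrow> bool" where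
  "word_over G S w \<longleftrightarrow> set w \<subseteq> S \<union> m_inv G ` S"

text \<open>\<open>word_length\<close> is a \<open>LEAST\<close> and says nothing where no word
  exists. This predicate carries the word itself, and "at most \<open>n\<close>" makes it monotone
  in the radius.\<close>

definition in_ball :: "('a, 'b) monoid_scheme \<Rightarrow> 'a set \<Rightarrow> nat \<Rightarrow> 'a \<Rightarrow> bool" where
  "in_ball G S n g \<longleftrightarrow>
     (\<exists>w. word_over G S w \<and> length w \<le> n \<and> foldr (\<otimes>\<^bsub>G\<^esub>) w \<one>\<^bsub>G\<^esub> = g)"

lemma word_length_eq:
  "word_length G S g =
     (LEAST n. \<exists>w. word_over G S w \<and> length w = n \<and> foldr (\<otimes>\<^bsub>G\<^esub>) w \<one>\<^bsub>G\<^esub> = g)"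
  by (simp add: word_length_def word_over_def)

lemma word_length_le:
  assumes "in_ball G S n g"
  shows "word_length G S g \<le> n"
proof -
  obtain w where w: "word_over G S w" "length w \<le> n" "foldr (\<otimes>\<^bsub>G\<^esub>) w \<one>\<^bsub>G\<^esub> = g"
    using assms by (auto simp: in_ball_def)
  then have "word_length G S g \<le> length w"
    unfolding word_length_eq by (intro Least_le) auto
  with w show ?thesis by simp
qed

text \<open>A word of any length makes the set under \<open>LEAST\<close> nonempty, so the minimum
  is attained.\<close>

lemma in_ball_word_length:
  assumes "in_ball G S n g"
  shows "in_ball G S (word_length G S g) g"
proof -
  have "\<exists>m. \<exists>w. word_over G S w \<and> length w = m \<and> foldr (\<otimes>\<^bsub>G\<^esub>) w \<one>\<^bsub>G\<^esub> = g"
    using assms by (auto simp: in_ball_def)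
  from LeastI_ex[OF this] show ?thesis
    unfolding in_ball_def word_length_eq[symmetric] by auto
qed

lemma in_ball_mono: "in_ball G S n g \<Longrightarrow> n \<le> m \<Longrightarrow> in_ball G S m g"
  by (auto simp: in_ball_def)

context group
begin

lemma word_over_carrier:
  assumes "S \<subseteq> carrier G" "word_over G S w"
  shows "set w \<subseteq> carrier G"
  using assms by (auto simp: word_over_def)

lemma foldr_closed: "set w \<subseteq> carrier G \<Longrightarrow> foldr (\<otimes>) w \<one> \<in> carrier G"
  by (induction w) auto

lemma foldr_mult_append:
  "set v \<subseteq> carrier G \<Longrightarrow> set w \<subseteq> carrier G \<Longrightarrow>
    foldr (\<otimes>) (v @ w) \<one> = foldr (\<otimes>) v \<one> \<otimes> foldr (\<otimes>) w \<one>"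
proof (induction v)
  case (Cons a v)
  then show ?case by (simp add: m_assoc foldr_closed)
qed (simp add: foldr_closed)

lemma in_ball_one: "in_ball G S 0 \<one>"
  unfolding in_ball_def word_over_def by (rule exI[of _ "[]"]) simp

lemma in_ball_incl: "S \<subseteq> carrier G \<Longrightarrow> s \<in> S \<Longrightarrow> in_ball G S 1 s"
  unfolding in_ball_def word_over_def by (rule exI[of _ "[s]"]) auto

lemma in_ball_inv_incl: "S \<subseteq> carrier G \<Longrightarrow> s \<in> S \<Longrightarrow> in_ball G S 1 (inv s)"
  unfolding in_ball_def word_over_def by (rule exI[of _ "[inv s]"]) auto

lemma in_ball_mult:
  assumes "S \<subseteq> carrier G" "in_ball G S m g" "in_ball G S n h"
  shows "in_ball G S (m + n) (g \<otimes> h)"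
proof -
  obtain v w where "word_over G S v" "length v \<le> m" "foldr (\<otimes>) v \<one> = g"
    "word_over G S w" "length w \<le> n" "foldr (\<otimes>) w \<one> = h"
    using assms by (auto simp: in_ball_def)
  then show ?thesis
    unfolding in_ball_def
    by (intro exI[of _ "v @ w"])
       (use foldr_mult_append word_over_carrier[OF assms(1)] in \<open>auto simp: word_over_def\<close>)
qed

lemma in_ball_foldr_inv:
  assumes "S \<subseteq> carrier G" "word_over G S w"
  shows "in_ball G S (length w) (inv (foldr (\<otimes>) w \<one>))"
  using assms(2)
proof (induction w)
  case Nil
  then show ?case using in_ball_one by simp
next
  case (Cons a w)
  then have w: "word_over G S w" and a: "a \<in> S \<union> m_inv G ` S" "a \<in> carrier G"
    using assms(1) by (auto simp: word_over_def)
  have "in_ball G S 1 (inv a)"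
    using a(1) assms(1) in_ball_incl[OF assms(1)] in_ball_inv_incl[OF assms(1)] by auto
  moreover have "foldr (\<otimes>) w \<one> \<in> carrier G"
    using foldr_closed word_over_carrier assms(1) w by blast
  ultimately show ?case
    using in_ball_mult[OF assms(1) Cons.IH[OF w]] a(2) by (fastforce simp: inv_mult_group)
qed

lemma in_ball_inv:
  assumes "S \<subseteq> carrier G" "in_ball G S n g"
  shows "in_ball G S n (inv g)"
proof -
  obtain w where w: "word_over G S w" "length w \<le> n" "foldr (\<otimes>) w \<one> = g"
    using assms by (auto simp: in_ball_def)
  show ?thesis
    using in_ball_mono[OF in_ball_foldr_inv[OF assms(1) w(1)] w(2)] w(3) by simp
qed

lemma in_ball_nat_pow:
  assumes "S \<subseteq> carrier G" "s \<in> S"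
  shows "in_ball G S n (s [^] n)"
proof (induction n)
  case 0
  then show ?case using in_ball_one by simp
next
  case (Suc n)
  then show ?case using in_ball_mult[OF assms(1) Suc in_ball_incl[OF assms]] by simp
qed

lemma generate_imp_in_ball:
  assumes "S \<subseteq> carrier G" "g \<in> generate G S"
  shows "\<exists>n. in_ball G S n g"
  using assms(2)
proof induction
  case one
  then show ?case using in_ball_one by blast
next
  case (incl h)
  then show ?case using in_ball_incl assms(1) by blast
next
  case (inv h)
  then show ?case using in_ball_inv_incl assms(1) by blast
next
  case (eng g h)
  then show ?case using in_ball_mult assms(1) by blast
qed

lemma in_ball_imp_generate:
  assumes "S \<subseteq> carrier G" "in_ball G S n g"
  shows "g \<in> generate G S"
proof -
  obtain w where "word_over G S w" "foldr (\<otimes>) w \<one> = g"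
    using assms by (auto simp: in_ball_def)
  then show ?thesis
  proof (induction w arbitrary: g)
    case Nil
    then show ?case by (auto intro: generate.one)
  next
    case (Cons a w)
    then show ?case
      by (auto simp: word_over_def intro!: generate.eng intro: generate.incl generate.inv)
  qed
qed

lemma countable_generate:
  assumes "S \<subseteq> carrier G" "finite S"
  shows "countable (generate G S)"
proof -
  have "generate G S \<subseteq> (\<lambda>w. foldr (\<otimes>) w \<one>) ` lists (S \<union> m_inv G ` S)"
  proof
    fix g assume "g \<in> generate G S"
    then obtain w where "word_over G S w" "foldr (\<otimes>) w \<one> = g"
      using generate_imp_in_ball[OF assms(1)] by (auto simp: in_ball_def)
    then show "g \<in> (\<lambda>w. foldr (\<otimes>) w \<one>) ` lists (S \<union> m_inv G ` S)"
      unfolding word_over_def by (intro image_eqI[of _ _ w]) auto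
  qed
  moreover have "countable (lists (S \<union> m_inv G ` S))"
    using assms by (intro countable_lists countable_finite) auto
  ultimately show ?thesis
    by (meson countable_image countable_subset)
qed

end

text \<open>Letters map to letters, inverses included. Word length bounds pass in this way between
  the permutation group and its copy on \<open>nat\<close>, in both directions.\<close>

lemma in_ball_hom:
  assumes "group_hom G K f" "S \<subseteq> carrier G" "in_ball G S n g"
  shows "in_ball K (f ` S) n (f g)"
proof -
  interpret group_hom G K f by fact
  obtain w where w: "word_over G S w" "length w \<le> n" "foldr (\<otimes>\<^bsub>G\<^esub>) w \<one>\<^bsub>G\<^esub> = g"
    using assms by (auto simp: in_ball_def)
  have "foldr (\<otimes>\<^bsub>K\<^esub>) (map f w) \<one>\<^bsub>K\<^esub> = f (foldr (\<otimes>\<^bsub>G\<^esub>) w \<one>\<^bsub>G\<^esub>)"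
    using G.word_over_carrier[OF assms(2) w(1)]
    by (induction w) (auto simp: G.foldr_closed)
  moreover have "word_over K (f ` S) (map f w)"
  proof -
    have "f a \<in> f ` S \<union> m_inv K ` f ` S" if "a \<in> set w" for a
    proof -
      have "a \<in> S \<union> m_inv G ` S" using that w(1) by (auto simp: word_over_def)
      then show ?thesis
      proof
        assume "a \<in> m_inv G ` S"
        then obtain s where "s \<in> S" "a = inv\<^bsub>G\<^esub> s" by auto
        then have "f a = inv\<^bsub>K\<^esub> (f s)" using assms(2) by auto
        with \<open>s \<in> S\<close> show ?thesis by auto
      qed auto
    qed
    then show ?thesis by (auto simp: word_over_def)
  qed
  ultimately show ?thesis
    unfolding in_ball_def using w by (intro exI[of _ "map f w"]) auto
qed

lemma (in group) in_ball_subgroup: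
  assumes "subgroup C G" "S \<subseteq> C" "in_ball G S n g"
  shows "in_ball (G\<lparr>carrier := C\<rparr>) S n g"
proof -
  have "m_inv (G\<lparr>carrier := C\<rparr>) ` S = m_inv G ` S"
    using assms(2) m_inv_consistent[OF assms(1)] by (intro image_cong) auto
  then show ?thesis using assms(3) by (simp add: in_ball_def word_over_def)
qed

text \<open>Transport of structure along an enumeration. It serves to realise the final group on the
  type \<open>nat\<close>.\<close>

lemma (in group) countable_group_nat_copy:
  assumes "countable (carrier G)"
  obtains N :: "nat monoid" and e where "group N" "e \<in> iso G N"
proof -
  let ?e = "to_nat_on (carrier G)"
  have inj: "inj_on ?e (carrier G)" using assms by (rule inj_on_to_nat_on)
  define d where "d = inv_into (carrier G) ?e"
  have d [simp]: "d (?e x) = x" if "x \<in> carrier G" for x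
    using that inj by (simp add: d_def)
  define N :: "nat monoid" where
    "N = \<lparr>carrier = ?e ` carrier G, mult = \<lambda>x y. ?e (d x \<otimes> d y), one = ?e \<one>\<rparr>"
  have "group N"
  proof (rule groupI)
    fix x assume "x \<in> carrier N"
    then obtain g where "g \<in> carrier G" "x = ?e g" by (auto simp: N_def)
    then show "\<exists>y\<in>carrier N. y \<otimes>\<^bsub>N\<^esub> x = \<one>\<^bsub>N\<^esub>"
      by (intro bexI[of _ "?e (inv g)"]) (auto simp: N_def)
  qed (auto simp: N_def m_assoc)
  moreover have "?e \<in> iso G N"
    using inj by (auto simp: iso_def hom_def N_def bij_betw_def)
  ultimately show ?thesis using that by blast
qed

lemma (in group) comm_int_pow_mult:
  assumes "x \<in> carrier G"
  shows "x [^] (i::int) \<otimes> x [^] (j::int) = x [^] j \<otimes> x [^] i"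
  using assms by (simp add: int_pow_mult[symmetric] add.commute)

section \<open>Quotients\<close>

lemma (in group) derived_subset_subgroup:
  assumes "subgroup N G"
    and "\<And>g h. g \<in> K \<Longrightarrow> h \<in> K \<Longrightarrow> g \<otimes> h \<otimes> inv g \<otimes> inv h \<in> N"
  shows "derived G K \<subseteq> N"
  unfolding derived_def by (rule generate_subgroup_incl) (use assms in auto)

text \<open>The projection maps the derived series of \<open>G\<close> onto that of the quotient, so
  a term inside \<open>H\<close> becomes trivial there.\<close>

lemma (in normal) solvable_Mod:
  assumes "(derived G ^^ n) (carrier G) \<subseteq> H"
  shows "solvable (G Mod H)" "derived_length (G Mod H) \<le> n"
proof -
  interpret Q: group "G Mod H" by (rule factorgroup_is_group)
  interpret p: group_hom G "G Mod H" "(#>) H"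
    by (intro group_hom.intro group_hom_axioms.intro is_group Q.is_group r_coset_hom_Mod)
  have carr: "carrier (G Mod H) = (#>) H ` carrier G"
    by (auto simp: FactGroup_def RCOSETS_def)
  have "(derived (G Mod H) ^^ n) (carrier (G Mod H)) = (#>) H ` (derived G ^^ n) (carrier G)"
    unfolding carr by (rule p.exp_of_derived_img) simp
  moreover have "(#>) H ` (derived G ^^ n) (carrier G) \<subseteq> {\<one>\<^bsub>G Mod H\<^esub>}"
  proof (rule image_subsetI)
    fix x assume "x \<in> (derived G ^^ n) (carrier G)"
    then have "x \<in> H" using assms by blast
    then have "H #> x = H" using coset_join2[OF _ subgroup_axioms] subset by blast
    then show "H #> x \<in> {\<one>\<^bsub>G Mod H\<^esub>}" by (simp add: FactGroup_def)
  qed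
  moreover have "\<one>\<^bsub>G Mod H\<^esub> \<in> (derived (G Mod H) ^^ n) (carrier (G Mod H))"
    using subgroup.one_closed[OF Q.exp_of_derived_is_subgroup[OF Q.subgroup_self]] .
  ultimately have *: "(derived (G Mod H) ^^ n) (carrier (G Mod H)) = {\<one>\<^bsub>G Mod H\<^esub>}"
    by blast
  then show "solvable (G Mod H)" using Q.solvable_iff_trivial_derived_seq by blast
  show "derived_length (G Mod H) \<le> n"
    unfolding derived_length_def using * by (rule Least_le)
qed

text \<open>The homomorphisms \<open>\<theta> i\<close> together separate points. On a finite
  \<open>T\<close> they restrict to the trivial map or to one of finitely many patterns, so the
  coordinates in \<open>J\<close> already detect every element generated by
  \<open>T\<close>.\<close>

lemma in_class_E_I:
  assumes K: "group K" and H: "group H"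
    and hom: "\<And>i. \<theta> i \<in> hom K H"
    and faithful: "\<And>k. k \<in> carrier K \<Longrightarrow> (\<And>i. \<theta> i k = \<one>\<^bsub>H\<^esub>) \<Longrightarrow> k = \<one>\<^bsub>K\<^esub>"
    and few: "\<And>T. finite T \<Longrightarrow> T \<subseteq> carrier K \<Longrightarrow>
       \<exists>J. finite J \<and> (\<forall>i. (\<forall>k\<in>T. \<theta> i k = \<one>\<^bsub>H\<^esub>) \<or> (\<exists>j\<in>J. \<forall>k\<in>T. \<theta> i k = \<theta> j k))"
  shows "in_class_E H K"
  unfolding in_class_E_def
proof (intro conjI allI impI K)
  fix T assume T: "finite T \<and> T \<subseteq> carrier K"
  interpret K: group K by fact
  interpret H: group H by fact
  interpret \<theta>: group_hom K H "\<theta> i" for i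
    by (intro group_hom.intro group_hom_axioms.intro K H hom)
  obtain J where J: "finite J"
    "\<And>i. (\<forall>k\<in>T. \<theta> i k = \<one>\<^bsub>H\<^esub>) \<or> (\<exists>j\<in>J. \<forall>k\<in>T. \<theta> i k = \<theta> j k)"
    using few T by metis
  obtain e :: "nat \<Rightarrow> _" where e: "bij_betw e {..<card J} J"
    using ex_bij_betw_nat_finite[OF J(1)] by (auto simp: atLeast0LessThan)
  let ?P = "product_group {..<card J} (\<lambda>_. H)"
  define f where "f k = (\<lambda>m\<in>{..<card J}. \<theta> (e m) k)" for k
  have gen: "carrier (subgroup_generated K T) = generate K T"
    using T by (simp add: carrier_subgroup_generated Int_absorb1)
  have gen_sub: "generate K T \<subseteq> carrier K" using T K.generate_incl by blast
  have "f \<in> hom (subgroup_generated K T) ?P"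
  proof (rule homI)
    fix x assume "x \<in> carrier (subgroup_generated K T)"
    then show "f x \<in> carrier ?P" using gen gen_sub by (auto simp: f_def)
  next
    fix x y assume "x \<in> carrier (subgroup_generated K T)" "y \<in> carrier (subgroup_generated K T)"
    then have "x \<in> carrier K" "y \<in> carrier K" using gen gen_sub by auto
    then show "f (x \<otimes>\<^bsub>subgroup_generated K T\<^esub> y) = f x \<otimes>\<^bsub>?P\<^esub> f y"
      by (auto simp: f_def fun_eq_iff)
  qed
  moreover have "inj_on f (carrier (subgroup_generated K T))"
    unfolding gen
  proof (rule inj_onI)
    fix x y assume x: "x \<in> generate K T" and y: "y \<in> generate K T" and eq: "f x = f y"
    define z where "z = x \<otimes>\<^bsub>K\<^esub> inv\<^bsub>K\<^esub> y"
    have xy: "x \<in> carrier K" "y \<in> carrier K" using x y gen_sub by auto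
    have z: "z \<in> generate K T"
      unfolding z_def using x y T K.generate_m_inv_closed generate.eng by metis
    have on_J: "\<theta> j z = \<one>\<^bsub>H\<^esub>" if "j \<in> J" for j
    proof -
      have "j \<in> e ` {..<card J}" using e that by (simp add: bij_betw_def)
      then obtain m where m: "m < card J" "e m = j" by auto
      then have "\<theta> j x = \<theta> j y" using fun_cong[OF eq, of m] by (simp add: f_def)
      then show ?thesis using xy by (simp add: z_def)
    qed
    \<comment> \<open>Homomorphisms that agree on \<open>T\<close> agree on all that it generates,
      so the index \<open>i\<close> detects nothing beyond the indices in \<open>J\<close>.\<close>
    have "\<theta> i z = \<one>\<^bsub>H\<^esub>" for i
      using J(2)[of i]
    proof
      assume *: "\<forall>k\<in>T. \<theta> i k = \<one>\<^bsub>H\<^esub>"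
      show ?thesis using z
        by induction (use * T gen_sub in \<open>auto simp: subset_iff\<close>)
    next
      assume "\<exists>j\<in>J. \<forall>k\<in>T. \<theta> i k = \<theta> j k"
      then obtain j where j: "j \<in> J" "\<forall>k\<in>T. \<theta> i k = \<theta> j k" by blast
      have "\<theta> i z = \<theta> j z" using z
        by induction (use j T gen_sub in \<open>auto simp: subset_iff\<close>)
      then show ?thesis using on_J j by simp
    qed
    then have "z = \<one>\<^bsub>K\<^esub>" using faithful z gen_sub by blast
    then show "x = y" unfolding z_def using xy by (metis K.inv_closed K.inv_equality K.inv_inv)
  qed
  ultimately have "f \<in> mon (subgroup_generated K T) ?P" by (simp add: mon_def)
  then have "mon (subgroup_generated K T) ?P \<noteq> {}" by (metis empty_iff)
  then show "\<exists>n::nat. mon (subgroup_generated K T) (product_group {..<n} (\<lambda>_. H)) \<noteq> {}"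
    by (rule exI)
qed

section \<open>Permutations with a real cocycle\<close>

text \<open>The unrestricted wreath product of the additive reals with the symmetric group of
  \<open>'s\<close>. The multiplication is the cocycle rule for the second component.\<close>

definition cocycle_group :: "(('s \<Rightarrow> 's) \<times> ('s \<Rightarrow> real)) monoid" where
  "cocycle_group = \<lparr>carrier = {g. bij (fst g)},
     mult = \<lambda>g h. (fst g \<circ> fst h, \<lambda>z. snd g (fst h z) + snd h z), one = (id, \<lambda>_. 0)\<rparr>"

lemma cocycle_group_simps [simp]:
  "g \<in> carrier cocycle_group \<longleftrightarrow> bij (fst g)"
  "fst (g \<otimes>\<^bsub>cocycle_group\<^esub> h) = fst g \<circ> fst h"
  "snd (g \<otimes>\<^bsub>cocycle_group\<^esub> h) z = snd g (fst h z) + snd h z"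
  "fst \<one>\<^bsub>cocycle_group\<^esub> = id"
  "snd \<one>\<^bsub>cocycle_group\<^esub> z = 0"
  by (simp_all add: cocycle_group_def)

lemma group_cocycle_group: "group cocycle_group"
proof (rule groupI)
  fix g :: "('s \<Rightarrow> 's) \<times> ('s \<Rightarrow> real)"
  assume "g \<in> carrier cocycle_group"
  then have g: "bij (fst g)" by simp
  show "\<exists>h\<in>carrier cocycle_group. h \<otimes>\<^bsub>cocycle_group\<^esub> g = \<one>\<^bsub>cocycle_group\<^esub>"
  proof (rule bexI)
    show "(inv_into UNIV (fst g), \<lambda>z. - snd g (inv_into UNIV (fst g) z)) \<in> carrier cocycle_group"
      using g by (simp add: bij_imp_bij_inv)
  qed (use g in \<open>simp add: prod_eq_iff fun_eq_iff bij_is_inj\<close>)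
qed (auto simp: prod_eq_iff fun_eq_iff bij_comp add.assoc)

interpretation cocycle: group cocycle_group
  by (rule group_cocycle_group)

text \<open>By the cocycle rule the value of a product at \<open>z\<close> is a sum of values of its
  letters along the orbit of \<open>z\<close>, one for each letter.\<close>

lemma cocycle_foldr_bound:
  assumes "\<And>s z. s \<in> S \<Longrightarrow> bij (fst s) \<and> \<bar>snd s z\<bar> \<le> 1" "word_over cocycle_group S w"
  shows "\<bar>snd (foldr (\<otimes>\<^bsub>cocycle_group\<^esub>) w \<one>\<^bsub>cocycle_group\<^esub>) z\<bar> \<le> real (length w)"
  using assms(2)
proof (induction w arbitrary: z)
  case (Cons a w)
  have "\<bar>snd a y\<bar> \<le> 1" for y
  proof (cases "a \<in> S")
    case False
    with Cons.prems obtain s where s: "s \<in> S" "a = inv\<^bsub>cocycle_group\<^esub> s"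
      by (auto simp: word_over_def)
    then have "s \<in> carrier cocycle_group" using assms(1) by simp
    then have "s \<otimes>\<^bsub>cocycle_group\<^esub> a = \<one>\<^bsub>cocycle_group\<^esub>" using s by (simp only: cocycle.r_inv)
    \<comment> \<open>An inverse letter takes the negative of some value of the generator, so it
      obeys the same bound.\<close>
    then have "snd s (fst a y) + snd a y = 0" by (metis cocycle_group_simps(3,5))
    with assms(1)[OF s(1), of "fst a y"] show ?thesis by linarith
  qed (use assms in blast)
  note a = this
  let ?g = "foldr (\<otimes>\<^bsub>cocycle_group\<^esub>) w \<one>\<^bsub>cocycle_group\<^esub>"
  have "word_over cocycle_group S w" using Cons.prems by (simp add: word_over_def)
  then have "\<bar>snd ?g z\<bar> \<le> real (length w)" by (rule Cons.IH)
  moreover have "\<bar>snd a (fst ?g z)\<bar> \<le> 1" by (rule a)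
  ultimately show ?case by simp
qed simp

lemma cocycle_word_length_bound:
  assumes "\<And>s z. s \<in> S \<Longrightarrow> bij (fst s) \<and> \<bar>snd s z\<bar> \<le> 1" "in_ball cocycle_group S n g"
  shows "\<bar>snd g z\<bar> \<le> real (word_length cocycle_group S g)"
proof -
  obtain w where w: "word_over cocycle_group S w" "length w \<le> word_length cocycle_group S g"
    "foldr (\<otimes>\<^bsub>cocycle_group\<^esub>) w \<one>\<^bsub>cocycle_group\<^esub> = g"
    using in_ball_word_length[OF assms(2)] unfolding in_ball_def by blast
  have "\<bar>snd g z\<bar> \<le> real (length w)"
    using cocycle_foldr_bound[OF assms(1) w(1)] w(3) by simp
  with w(2) show ?thesis by linarith
qed

section \<open>The finitely generated group\<close>

definition parabola :: "nat \<Rightarrow> complex" where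
  "parabola u = Complex (real u) ((real u)\<^sup>2)"

lemma parabola_inj: "parabola u = parabola v \<longleftrightarrow> u = v"
  by (simp add: parabola_def)

lemma finite_quadratic_roots:
  fixes a b c :: real
  assumes "a \<noteq> 0 \<or> b \<noteq> 0 \<or> c \<noteq> 0"
  shows "finite {x. a * x\<^sup>2 + b * x + c = 0}"
proof -
  have "finite {x. poly [:c, b, a:] x = 0}"
    using assms by (intro poly_roots_finite) auto
  then show ?thesis by (simp add: algebra_simps power2_eq_square)
qed

text \<open>Lying on the parabola twice gives a quadratic equation for the first parameter. It is
  not the zero equation, because the two affine maps differ.\<close>

lemma finite_affine_parabola:
  fixes c c' :: real and r r' :: complex
  assumes "(c, r) \<noteq> (c', r')" "c \<noteq> 0" "c' \<noteq> 0"
  shows "finite {q. c *\<^sub>R q + r \<in> range parabola \<and> c' *\<^sub>R q + r' \<in> range parabola}"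
proof -
  \<comment> \<open>The map with ratio \<open>d\<close> and translation \<open>t\<close> carries
    \<open>c *\<^sub>R q + r\<close> to \<open>c' *\<^sub>R q + r'\<close>; it is not the
    identity.\<close>
  define d where "d = c' / c"
  define t where "t = r' - d *\<^sub>R r"
  have d: "d \<noteq> 0" using assms by (simp add: d_def)
  have dt: "d \<noteq> 1 \<or> Re t \<noteq> 0 \<or> Im t \<noteq> 0"
    using assms by (auto simp: d_def t_def complex_eq_iff)
  define R where "R = {x. (d\<^sup>2 - d) * x\<^sup>2 + (2 * d * Re t) * x + ((Re t)\<^sup>2 - Im t) = 0}"
  have "finite R"
    unfolding R_def using d dt by (intro finite_quadratic_roots) (auto simp: power2_eq_square)
  moreover have "{q. c *\<^sub>R q + r \<in> range parabola \<and> c' *\<^sub>R q + r' \<in> range parabola}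
    \<subseteq> (\<lambda>x. (1 / c) *\<^sub>R (Complex x (x\<^sup>2) - r)) ` R"
  proof clarify
    fix q u v assume u: "c *\<^sub>R q + r = parabola u" and v: "c' *\<^sub>R q + r' = parabola v"
    have "parabola v = d *\<^sub>R parabola u + t"
      using assms(2) by (simp flip: u v add: d_def t_def scaleR_add_right)
    then have "real v = d * real u + Re t" "(real v)\<^sup>2 = d * (real u)\<^sup>2 + Im t"
      by (auto simp: parabola_def complex_eq_iff)
    then have "real u \<in> R"
      unfolding R_def by (simp add: power2_eq_square algebra_simps)
    moreover have "q = (1 / c) *\<^sub>R (Complex (real u) ((real u)\<^sup>2) - r)"
      using assms(2) by (simp flip: u[unfolded parabola_def])
    ultimately show "q \<in> (\<lambda>x. (1 / c) *\<^sub>R (Complex x (x\<^sup>2) - r)) ` R" by blast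
  qed
  ultimately show ?thesis by (meson finite_imageI finite_subset)
qed

text \<open>\<open>\<nu>\<close> numbers the elements of \<open>H\<close>, and
  \<open>parabola (\<nu> h)\<close> is the point reserved for \<open>h\<close>. A bound on
  \<open>\<nu>\<close> enters only with the word length estimate.\<close>

locale weighted_group = group H for H (structure) +
  fixes l :: "'a \<Rightarrow> nat" and \<nu> :: "'a \<Rightarrow> nat"
  assumes length: "length_function H l"
    and \<nu>_inj: "inj_on \<nu> (carrier H)"
begin

lemma l_one: "l \<one> = 0"
  using length unfolding length_function_def by (metis one_closed)

lemma l_eq_0: "h \<in> carrier H \<Longrightarrow> l h = 0 \<longleftrightarrow> h = \<one>"
  using length unfolding length_function_def by metis

lemma l_inv: "h \<in> carrier H \<Longrightarrow> l (inv h) = l h"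
  using length unfolding length_function_def by metis

lemma l_mult: "g \<in> carrier H \<Longrightarrow> h \<in> carrier H \<Longrightarrow> l (g \<otimes> h) \<le> l g + l h"
  using length unfolding length_function_def by metis

lemma l_diff:
  assumes "g \<in> carrier H" "x \<in> carrier H"
  shows "\<bar>real (l (g \<otimes> x)) - real (l x)\<bar> \<le> real (l g)"
proof -
  have "inv g \<otimes> (g \<otimes> x) = x" using assms by (simp add: m_assoc[symmetric])
  then have "l x \<le> l g + l (g \<otimes> x)"
    using l_mult[of "inv g" "g \<otimes> x"] assms by (simp add: l_inv)
  with l_mult[OF assms] show ?thesis by linarith
qed

text \<open>The inverse of the assignment of points to elements, extended by the identity, so that
  its support lies on the parabola.\<close>

definition f :: "complex \<Rightarrow> 'a" where
  "f q = (if q \<in> (\<lambda>h. parabola (\<nu> h)) ` carrier H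
          then inv_into (carrier H) (\<lambda>h. parabola (\<nu> h)) q else \<one>)"

lemma f_parabola: "h \<in> carrier H \<Longrightarrow> f (parabola (\<nu> h)) = h"
proof -
  have "inj_on (\<lambda>h. parabola (\<nu> h)) (carrier H)"
    using \<nu>_inj by (simp add: inj_on_def parabola_inj)
  then show "h \<in> carrier H \<Longrightarrow> f (parabola (\<nu> h)) = h"
    using inv_into_f_f[of "\<lambda>h. parabola (\<nu> h)" "carrier H" h] by (simp add: f_def)
qed

lemma f_closed [simp]: "f q \<in> carrier H"
  by (auto simp: f_def intro: inv_into_into)

lemma f_nontrivial: "f q \<noteq> \<one> \<Longrightarrow> q \<in> range parabola"
  by (auto simp: f_def split: if_splits)

text \<open>In \<open>(q, n, x)\<close> the last component is only meaningful in \<open>carrier H\<close>; other values are fixed.\<close>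

definition act :: "real \<Rightarrow> complex \<Rightarrow> (complex \<Rightarrow> int) \<Rightarrow> (complex \<Rightarrow> int \<Rightarrow> 'a) \<Rightarrow>
    complex \<times> int \<times> 'a \<Rightarrow> complex \<times> int \<times> 'a" where
  "act c r s \<phi> = (\<lambda>(q, n, x). (c *\<^sub>R q + r, n + s q, if x \<in> carrier H then \<phi> q n \<otimes> x else x))"

lemma act_simp:
  "act c r s \<phi> (q, n, x) = (c *\<^sub>R q + r, n + s q, if x \<in> carrier H then \<phi> q n \<otimes> x else x)"
  by (simp add: act_def)

text \<open>The right factor acts first, so the data of the left factor are read at the affine image
  of \<open>q\<close>, and \<open>\<phi>\<close> moreover at the shifted level
  \<open>n + u q\<close>.\<close>

lemma act_comp:
  assumes "\<And>q n. \<phi> q n \<in> carrier H" "\<And>q n. \<psi> q n \<in> carrier H"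
  shows "act c r s \<phi> \<circ> act d t u \<psi> =
    act (c * d) (c *\<^sub>R t + r) (\<lambda>q. u q + s (d *\<^sub>R q + t))
      (\<lambda>q n. \<phi> (d *\<^sub>R q + t) (n + u q) \<otimes> \<psi> q n)"
  using assms by (auto simp: fun_eq_iff act_def m_assoc scaleR_add_right)

lemma act_id: "act 1 0 (\<lambda>_. 0) (\<lambda>_ _. \<one>) = id"
  by (auto simp: fun_eq_iff act_def)

lemma bij_act:
  assumes "c \<noteq> 0" "\<And>q n. \<phi> q n \<in> carrier H"
  shows "bij (act c r s \<phi>)"
proof (rule o_bij)
  let ?A = "\<lambda>q. (1 / c) *\<^sub>R q - (1 / c) *\<^sub>R r"
  let ?g = "act (1 / c) (- ((1 / c) *\<^sub>R r)) (\<lambda>q. - s (?A q)) (\<lambda>q n. inv (\<phi> (?A q) (n - s (?A q))))"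
  show "?g \<circ> act c r s \<phi> = id" "act c r s \<phi> \<circ> ?g = id"
    using assms by (simp_all add: act_comp act_id[symmetric] scaleR_add_right)
qed

definition aff :: "real \<Rightarrow> complex \<Rightarrow> _" where
  "aff c r = (act c r (\<lambda>_. 0) (\<lambda>_ _. \<one>), \<lambda>_::complex \<times> int \<times> 'a. 0::real)"

definition shift :: "(complex \<times> int \<times> 'a \<Rightarrow> complex \<times> int \<times> 'a) \<times> (complex \<times> int \<times> 'a \<Rightarrow> real)" where
  "shift = (act 1 0 (\<lambda>q. if q = 0 then 1 else 0) (\<lambda>_ _. \<one>), \<lambda>_. 0)"

definition mover :: "(complex \<times> int \<times> 'a \<Rightarrow> complex \<times> int \<times> 'a) \<times> (complex \<times> int \<times> 'a \<Rightarrow> real)" where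
  "mover = (act 1 0 (\<lambda>_. 0) (\<lambda>q n. if 0 \<le> n then f q else \<one>), \<lambda>_. 0)"

text \<open>With \<open>f q = h\<close>, the product \<open>counter [^] l h \<otimes> mover\<close> acts over \<open>q\<close> by \<open>h\<close> with the
  coboundary of \<open>l\<close> as cocycle, although \<open>counter\<close> itself has a cocycle bounded by \<open>1\<close>. Where
  \<open>f q = \<one>\<close> the quotient is \<open>0 / 0 = 0\<close>.\<close>

definition counter :: "(complex \<times> int \<times> 'a \<Rightarrow> complex \<times> int \<times> 'a) \<times> (complex \<times> int \<times> 'a \<Rightarrow> real)" where
  "counter = (id, \<lambda>(q, n, x). if 0 \<le> n \<and> x \<in> carrier H
     then (real (l (inv (f q) \<otimes> x)) - real (l x)) / real (l (f q)) else 0)"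

definition gens where
  "gens = {aff 2 0, aff 1 1, aff 1 \<i>, shift, mover, counter}"

text \<open>The cocycle is the coboundary of \<open>- l\<close> along left multiplication by
  \<open>h\<close>. It telescopes under products, which makes \<open>emb\<close> multiplicative, and
  at \<open>x = \<one>\<close> it equals \<open>- l h\<close>.\<close>

definition emb :: "'a \<Rightarrow> (complex \<times> int \<times> 'a \<Rightarrow> complex \<times> int \<times> 'a) \<times> (complex \<times> int \<times> 'a \<Rightarrow> real)" where
  "emb h = (act 1 0 (\<lambda>_. 0) (\<lambda>q n. if q = 0 \<and> n = 0 then h else \<one>),
     \<lambda>(q, n, x). if q = 0 \<and> n = 0 \<and> x \<in> carrier H then real (l x) - real (l (h \<otimes> x)) else 0)"

lemma aff_carrier: "c \<noteq> 0 \<Longrightarrow> aff c r \<in> carrier cocycle_group"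
  by (simp add: aff_def bij_act)

lemma gens_carrier: "gens \<subseteq> carrier cocycle_group"
  by (auto simp: gens_def aff_def shift_def mover_def counter_def intro!: bij_act)

lemma emb_carrier: "h \<in> carrier H \<Longrightarrow> emb h \<in> carrier cocycle_group"
  by (auto simp: emb_def intro!: bij_act)

lemma gens_mem: "aff 2 0 \<in> gens" "aff 1 1 \<in> gens" "aff 1 \<i> \<in> gens"
    "shift \<in> gens" "mover \<in> gens" "counter \<in> gens"
  by (simp_all add: gens_def)

lemmas gens_in_ball = gens_mem[THEN cocycle.in_ball_incl[OF gens_carrier]]

text \<open>Only \<open>counter\<close> has a nonzero cocycle, and by \<open>l_diff\<close> its
  numerator is at most its denominator in absolute value.\<close>

lemma gens_bounded:
  assumes "g \<in> gens"
  shows "bij (fst g) \<and> \<bar>snd g z\<bar> \<le> 1"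
proof
  show "bij (fst g)" using assms gens_carrier by auto
  obtain q n x where z: "z = (q, n, x)" by (cases z)
  have "\<bar>real (l (inv (f q) \<otimes> x)) - real (l x)\<bar> / real (l (f q)) \<le> 1" if "x \<in> carrier H"
    using l_diff[of "inv (f q)" x] that by (simp add: l_inv divide_le_eq)
  then have "\<bar>snd counter z\<bar> \<le> 1" by (simp add: counter_def z)
  then show "\<bar>snd g z\<bar> \<le> 1"
    using assms by (auto simp: gens_def aff_def shift_def mover_def)
qed

lemma emb_mult:
  assumes "g \<in> carrier H" "h \<in> carrier H"
  shows "emb (g \<otimes> h) = emb g \<otimes>\<^bsub>cocycle_group\<^esub> emb h"
proof (rule prod_eqI)
  show "fst (emb (g \<otimes> h)) = fst (emb g \<otimes>\<^bsub>cocycle_group\<^esub> emb h)"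
    using assms by (auto simp: emb_def act_comp fun_eq_iff act_simp)
  show "snd (emb (g \<otimes> h)) = snd (emb g \<otimes>\<^bsub>cocycle_group\<^esub> emb h)"
    using assms by (auto simp: emb_def fun_eq_iff act_simp m_assoc)
qed

text \<open>The cocycle is evaluated at the identity over \<open>(0, 0)\<close>, where it equals
  \<open>- l h\<close> because \<open>l\<close> vanishes at the identity.\<close>

lemma emb_lower_bound:
  assumes "h \<in> carrier H" "in_ball cocycle_group gens n (emb h)"
  shows "l h \<le> word_length cocycle_group gens (emb h)"
proof -
  have "\<bar>snd (emb h) (0, 0, \<one>)\<bar> \<le> real (word_length cocycle_group gens (emb h))"
    using cocycle_word_length_bound[OF gens_bounded assms(2)] .
  then show ?thesis using assms(1) by (simp add: emb_def l_one)
qed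

section \<open>Short words for the embedded elements\<close>

lemma aff_mult: "aff c r \<otimes>\<^bsub>cocycle_group\<^esub> aff d t = aff (c * d) (c *\<^sub>R t + r)"
  by (simp add: prod_eq_iff fun_eq_iff aff_def act_comp)

text \<open>Horner's scheme on the binary digits of both coordinates at once: each digit position
  costs one doubling and at most two unit translations. Of the ratio \<open>c\<close> only
  \<open>c \<noteq> 0\<close> matters later.\<close>

lemma aff_in_ball:
  assumes "u < 2 ^ m" "v < 2 ^ m"
  shows "\<exists>c. c \<noteq> 0 \<and> in_ball cocycle_group gens (3 * m) (aff c (Complex (real u) (real v)))"
  using assms
proof (induction m arbitrary: u v)
  case 0
  have "aff 1 0 = \<one>\<^bsub>cocycle_group\<^esub>" by (simp add: prod_eq_iff fun_eq_iff aff_def act_id)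
  moreover have "Complex 0 0 = 0" by (simp add: complex_eq_iff)
  ultimately show ?case using 0 cocycle.in_ball_one by (intro exI[of _ 1]) simp
next
  case (Suc m)
  let ?ball = "in_ball cocycle_group gens"
  note mult = cocycle.in_ball_mult[OF gens_carrier]
  have id: "aff 1 0 = \<one>\<^bsub>cocycle_group\<^esub>" by (simp add: prod_eq_iff fun_eq_iff aff_def act_id)
  \<comment> \<open>A digit 0 is charged one letter as well, so that all digits are treated
    alike.\<close>
  have "?ball 1 (aff 1 0)"
    unfolding id by (rule in_ball_mono[OF cocycle.in_ball_one]) simp
  moreover have "?ball 1 (aff 1 1)" "?ball 1 (aff 1 \<i>)" "?ball 1 (aff 2 0)"
    by (fact gens_in_ball)+
  moreover have "real (u mod 2) = 0 \<or> real (u mod 2) = 1" "real (v mod 2) = 0 \<or> real (v mod 2) = 1"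
    by auto
  ultimately have digits: "?ball 1 (aff 1 (Complex (real (u mod 2)) 0))"
    "?ball 1 (aff 1 (Complex 0 (real (v mod 2))))" and two: "?ball 1 (aff 2 0)"
    by (auto simp: Complex_eq)
  have "u div 2 < 2 ^ m" "v div 2 < 2 ^ m" using Suc.prems by auto
  then obtain c where c: "c \<noteq> 0" "?ball (3 * m) (aff c (Complex (real (u div 2)) (real (v div 2))))"
    using Suc.IH by blast
  have "u = 2 * (u div 2) + u mod 2" "v = 2 * (v div 2) + v mod 2" by auto
  then have "real u = 2 * real (u div 2) + real (u mod 2)"
    "real v = 2 * real (v div 2) + real (v mod 2)"
    by (metis of_nat_add of_nat_mult of_nat_numeral)+
  then have "aff 1 (Complex (real (u mod 2)) 0) \<otimes>\<^bsub>cocycle_group\<^esub>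
      (aff 1 (Complex 0 (real (v mod 2))) \<otimes>\<^bsub>cocycle_group\<^esub>
        (aff 2 0 \<otimes>\<^bsub>cocycle_group\<^esub> aff c (Complex (real (u div 2)) (real (v div 2))))) =
    aff (2 * c) (Complex (real u) (real v))"
    by (simp add: aff_mult complex_eq_iff Complex_eq scaleR_conv_of_real algebra_simps)
  then have "?ball (1 + (1 + (1 + 3 * m))) (aff (2 * c) (Complex (real u) (real v)))"
    using mult[OF digits(1) mult[OF digits(2) mult[OF two c(2)]]] by simp
  then have "?ball (3 * Suc m) (aff (2 * c) (Complex (real u) (real v)))"
    by (rule in_ball_mono) simp
  then show ?case using c(1) by (intro exI[of _ "2 * c"]) simp
qed

text \<open>The conjugate of \<open>counter ^ l h * mover\<close> by \<open>aff c p\<close>, where \<open>f p = h\<close>. Its commutator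
  with \<open>shift\<close> is concentrated at \<open>q = 0\<close>, \<open>n = 0\<close>.\<close>

definition ray :: "real \<Rightarrow> complex \<Rightarrow> nat \<Rightarrow>
    (complex \<times> int \<times> 'a \<Rightarrow> complex \<times> int \<times> 'a) \<times> (complex \<times> int \<times> 'a \<Rightarrow> real)" where
  "ray c p k = (act 1 0 (\<lambda>_. 0) (\<lambda>q n. if 0 \<le> n then f (c *\<^sub>R q + p) else \<one>),
     \<lambda>(q, n, x). if 0 \<le> n \<and> x \<in> carrier H
       then real k * ((real (l x) - real (l (f (c *\<^sub>R q + p) \<otimes> x))) / real (l (f (c *\<^sub>R q + p))))
       else 0)"

lemma ray_carrier: "ray c p k \<in> carrier cocycle_group"
  by (auto simp: ray_def intro!: bij_act)

lemma fst_counter: "fst counter = id"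
  by (simp add: counter_def)

lemma snd_counter: "snd counter (q, n, x) = (if 0 \<le> n \<and> x \<in> carrier H
     then (real (l (inv (f q) \<otimes> x)) - real (l x)) / real (l (f q)) else 0)"
  by (simp add: counter_def)

lemma counter_pow:
  "fst (counter [^]\<^bsub>cocycle_group\<^esub> k) = id" "snd (counter [^]\<^bsub>cocycle_group\<^esub> k) z = real k * snd counter z"
  by (induction k arbitrary: z) (simp_all add: fst_counter algebra_simps)

text \<open>Free of inverses, so both components can be compared pointwise. After
  \<open>mover\<close> the cocycle of \<open>counter\<close> is read at
  \<open>f q \<otimes> x\<close>, where its numerator becomes
  \<open>l x - l (f q \<otimes> x)\<close>.\<close>

lemma ray_conj:
  "aff c p \<otimes>\<^bsub>cocycle_group\<^esub> ray c p k =
   (counter [^]\<^bsub>cocycle_group\<^esub> k \<otimes>\<^bsub>cocycle_group\<^esub> mover) \<otimes>\<^bsub>cocycle_group\<^esub> aff c p"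
proof (rule prod_eqI)
  show "fst (aff c p \<otimes>\<^bsub>cocycle_group\<^esub> ray c p k) =
    fst ((counter [^]\<^bsub>cocycle_group\<^esub> k \<otimes>\<^bsub>cocycle_group\<^esub> mover) \<otimes>\<^bsub>cocycle_group\<^esub> aff c p)"
    by (auto simp: counter_pow aff_def ray_def mover_def fun_eq_iff act_simp)
  show "snd (aff c p \<otimes>\<^bsub>cocycle_group\<^esub> ray c p k) =
    snd ((counter [^]\<^bsub>cocycle_group\<^esub> k \<otimes>\<^bsub>cocycle_group\<^esub> mover) \<otimes>\<^bsub>cocycle_group\<^esub> aff c p)"
    by (auto simp: counter_pow aff_def ray_def mover_def snd_counter fun_eq_iff act_simp
        m_assoc[symmetric])
qed

text \<open>Conjugation by \<open>shift\<close> leaves the ray unchanged over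
  \<open>q \<noteq> 0\<close> and makes it start at \<open>n = 1\<close> over \<open>q = 0\<close>.
  The commutator therefore lives at \<open>(0, 0)\<close>, where the value is
  \<open>f p = h\<close>.\<close>

lemma emb_commutator:
  assumes "h \<in> carrier H" "f p = h"
  shows "emb h \<otimes>\<^bsub>cocycle_group\<^esub> (shift \<otimes>\<^bsub>cocycle_group\<^esub> ray c p (l h)) = ray c p (l h) \<otimes>\<^bsub>cocycle_group\<^esub> shift"
proof (rule prod_eqI)
  show "fst (emb h \<otimes>\<^bsub>cocycle_group\<^esub> (shift \<otimes>\<^bsub>cocycle_group\<^esub> ray c p (l h))) =
    fst (ray c p (l h) \<otimes>\<^bsub>cocycle_group\<^esub> shift)"
    using assms by (auto simp: emb_def shift_def ray_def fun_eq_iff act_simp)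
  \<comment> \<open>If \<open>l h = 0\<close> the division by zero does no harm: then
    \<open>h\<close> is the identity and both sides vanish.\<close>
  have *: "real (l h) * ((real (l x) - real (l (h \<otimes> x))) / real (l h)) = real (l x) - real (l (h \<otimes> x))"
    if "x \<in> carrier H" for x
    using l_eq_0[OF assms(1)] that by (cases "l h = 0") auto
  show "snd (emb h \<otimes>\<^bsub>cocycle_group\<^esub> (shift \<otimes>\<^bsub>cocycle_group\<^esub> ray c p (l h))) =
    snd (ray c p (l h) \<otimes>\<^bsub>cocycle_group\<^esub> shift)"
    using assms * by (auto simp: emb_def shift_def ray_def fun_eq_iff act_simp)
qed

text \<open>The commutator contains two shifts and two rays, one of them inverted. Each ray costs
  \<open>l h + 1\<close> letters and two affine words of \<open>3 * m\<close> letters.\<close>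

lemma emb_in_ball:
  assumes h: "h \<in> carrier H" and m: "(\<nu> h)\<^sup>2 < 2 ^ m"
  shows "in_ball cocycle_group gens (12 * m + 2 * l h + 4) (emb h)"
proof -
  let ?W = "cocycle_group :: ((complex \<times> int \<times> 'a \<Rightarrow> complex \<times> int \<times> 'a) \<times> (complex \<times> int \<times> 'a \<Rightarrow> real)) monoid"
  let ?ball = "in_ball ?W gens"
  note mult = cocycle.in_ball_mult[OF gens_carrier] and inv = cocycle.in_ball_inv[OF gens_carrier]
  define p where "p = parabola (\<nu> h)"
  have p: "f p = h" using f_parabola h by (simp add: p_def)
  \<comment> \<open>Hence both coordinates of the point \<open>p\<close> have at most
    \<open>m\<close> binary digits.\<close>
  have "\<nu> h \<le> (\<nu> h)\<^sup>2" by (simp add: power2_eq_square)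
  then have "\<nu> h < 2 ^ m" using m by linarith
  then obtain c where c: "c \<noteq> 0" "?ball (3 * m) (aff c p)"
    using aff_in_ball[OF _ m] by (force simp: p_def parabola_def)
  have carr: "aff c p \<in> carrier ?W" "mover \<in> carrier ?W" "counter \<in> carrier ?W"
      "shift \<in> carrier ?W"
    using gens_carrier gens_mem aff_carrier[OF c(1)] by auto
  have bs: "?ball 1 mover" "?ball 1 shift" "?ball (l h) (counter [^]\<^bsub>?W\<^esub> l h)"
    by (fact gens_in_ball cocycle.in_ball_nat_pow[OF gens_carrier gens_mem(6)])+
  let ?y = "counter [^]\<^bsub>?W\<^esub> l h \<otimes>\<^bsub>?W\<^esub> mover"
  have y: "?y \<in> carrier ?W" "?ball (l h + 1) ?y"
    using carr mult[OF bs(3,1)] by (simp_all del: cocycle_group_simps)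
  have "ray c p (l h) = inv\<^bsub>?W\<^esub> (aff c p) \<otimes>\<^bsub>?W\<^esub> (?y \<otimes>\<^bsub>?W\<^esub> aff c p)"
    using ray_conj[of c p "l h"] carr(1) y(1) ray_carrier[of c p "l h"]
    by (metis cocycle.inv_solve_left cocycle.m_closed)
  then have ray: "?ball (3 * m + (l h + 1 + 3 * m)) (ray c p (l h))"
    using mult[OF inv[OF c(2)] mult[OF y(2) c(2)]] by simp
  have "emb h = (ray c p (l h) \<otimes>\<^bsub>?W\<^esub> shift) \<otimes>\<^bsub>?W\<^esub> inv\<^bsub>?W\<^esub> (shift \<otimes>\<^bsub>?W\<^esub> ray c p (l h))"
    using emb_commutator[OF h p, of c] emb_carrier[OF h] carr(4) ray_carrier[of c p "l h"]
    by (metis cocycle.inv_solve_right cocycle.m_closed)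
  then have "?ball (3 * m + (l h + 1 + 3 * m) + 1 + (1 + (3 * m + (l h + 1 + 3 * m)))) (emb h)"
    using mult[OF mult[OF ray bs(2)] inv[OF mult[OF bs(2) ray]]] by simp
  then show ?thesis by (rule in_ball_mono) simp
qed

section \<open>Almost disjoint supports\<close>

text \<open>The shape over \<open>q\<close> of a product of affine conjugates of
  \<open>mover\<close>, away from collisions: a single power of \<open>f\<close> at one of finitely
  many affine images of \<open>q\<close>, cut off below \<open>n = 0\<close>.\<close>

definition tame :: "(real \<times> complex) set \<Rightarrow> (int \<Rightarrow> 'a) \<Rightarrow> complex \<Rightarrow> bool" where
  "tame F \<psi> q \<longleftrightarrow> (\<exists>a\<in>F. \<exists>k::int. \<forall>n. \<psi> n = (if 0 \<le> n then f (fst a *\<^sub>R q + snd a) [^] k else \<one>))"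

definition ev_const :: "(int \<Rightarrow> 'a) \<Rightarrow> bool" where
  "ev_const \<psi> \<longleftrightarrow> (\<exists>N y. \<forall>n. (N \<le> n \<longrightarrow> \<psi> n = y) \<and> (n \<le> - N \<longrightarrow> \<psi> n = \<one>))"

text \<open>The invariant satisfied by the permutation part of every element of the generated group.
  Over the finite set \<open>E\<close> only eventual constancy along the integers is kept.\<close>

definition admissible :: "(complex \<times> int \<times> 'a \<Rightarrow> complex \<times> int \<times> 'a) \<Rightarrow> real \<Rightarrow> complex \<Rightarrow>
    (complex \<Rightarrow> int) \<Rightarrow> (complex \<Rightarrow> int \<Rightarrow> 'a) \<Rightarrow> bool" where
  "admissible \<pi> c r s \<phi> \<longleftrightarrow> \<pi> = act c r s \<phi> \<and> c \<noteq> 0 \<and> (\<forall>q n. \<phi> q n \<in> carrier H) \<and>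
     (\<forall>q. ev_const (\<phi> q)) \<and>
     (\<exists>E F. finite E \<and> finite F \<and> fst ` F \<subseteq> - {0} \<and> (\<forall>q. q \<notin> E \<longrightarrow> s q = 0 \<and> tame F (\<phi> q) q))"

definition overlap :: "(real \<times> complex) set \<Rightarrow> (real \<times> complex) set \<Rightarrow> complex set" where
  "overlap F F' = (\<Union>a\<in>F. \<Union>b\<in>F' - {a}.
     {q. fst a *\<^sub>R q + snd a \<in> range parabola \<and> fst b *\<^sub>R q + snd b \<in> range parabola})"

lemma finite_overlap:
  assumes "finite F" "finite F'" "fst ` F \<subseteq> - {0}" "fst ` F' \<subseteq> - {0}"
  shows "finite (overlap F F')"
  unfolding overlap_def using assms
  by (intro finite_UN_I finite_affine_parabola finite_Diff) force+

text \<open>Outside the overlap two distinct affine images of \<open>q\<close> are not both on the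
  parabola. At one of them \<open>f\<close> is trivial, and that function is rewritten as the zeroth
  power at the other image.\<close>

lemma tame_common:
  assumes "tame F \<psi> q" "tame F' \<chi> q" "q \<notin> overlap F F'"
  obtains a i j where "a \<in> F \<union> F'"
    "\<And>n. \<psi> n = (if 0 \<le> n then f (fst a *\<^sub>R q + snd a) [^] (i::int) else \<one>)"
    "\<And>n. \<chi> n = (if 0 \<le> n then f (fst a *\<^sub>R q + snd a) [^] (j::int) else \<one>)"
proof -
  obtain a i where a: "a \<in> F" "\<And>n. \<psi> n = (if 0 \<le> n then f (fst a *\<^sub>R q + snd a) [^] (i::int) else \<one>)"
    using assms(1) unfolding tame_def by blast
  obtain b j where b: "b \<in> F'" "\<And>n. \<chi> n = (if 0 \<le> n then f (fst b *\<^sub>R q + snd b) [^] (j::int) else \<one>)"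
    using assms(2) unfolding tame_def by blast
  have "a = b \<or> fst a *\<^sub>R q + snd a \<notin> range parabola \<or> fst b *\<^sub>R q + snd b \<notin> range parabola"
    using assms(3) a(1) b(1) by (auto simp: overlap_def)
  then consider "a = b" | "f (fst a *\<^sub>R q + snd a) = \<one>" | "f (fst b *\<^sub>R q + snd b) = \<one>"
    using f_nontrivial by metis
  then show ?thesis
  proof cases
    case 1
    then show ?thesis using a b by (intro that[of a i j]) auto
  next
    case 2
    then have "\<psi> n = (if 0 \<le> n then f (fst b *\<^sub>R q + snd b) [^] (0::int) else \<one>)" for n
      using a(2) by simp
    then show ?thesis using b by (intro that[of b 0 j]) auto
  next
    case 3
    then have "\<chi> n = (if 0 \<le> n then f (fst a *\<^sub>R q + snd a) [^] (0::int) else \<one>)" for n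
      using b(2) by simp
    then show ?thesis using a by (intro that[of a i 0]) auto
  qed
qed

lemma ev_const_mult:
  assumes "ev_const \<psi>" "ev_const \<chi>"
  shows "ev_const (\<lambda>n. \<psi> (n + k) \<otimes> \<chi> n)"
proof -
  obtain N y where N: "\<And>n. N \<le> n \<Longrightarrow> \<psi> n = y" "\<And>n. n \<le> - N \<Longrightarrow> \<psi> n = \<one>"
    using assms(1) unfolding ev_const_def by blast
  obtain M z where M: "\<And>n. M \<le> n \<Longrightarrow> \<chi> n = z" "\<And>n. n \<le> - M \<Longrightarrow> \<chi> n = \<one>"
    using assms(2) unfolding ev_const_def by blast
  show ?thesis
    unfolding ev_const_def
    by (rule exI[of _ "max (N + \<bar>k\<bar>) M"], rule exI[of _ "y \<otimes> z"]) (auto simp: N M)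
qed

lemma admissibleE:
  assumes "admissible \<pi> c r s \<phi>"
  obtains E F where "finite E" "finite F" "fst ` F \<subseteq> - {0}"
    "\<And>q. q \<notin> E \<Longrightarrow> s q = 0" "\<And>q. q \<notin> E \<Longrightarrow> tame F (\<phi> q) q"
proof -
  have "\<exists>E F. finite E \<and> finite F \<and> fst ` F \<subseteq> - {0} \<and> (\<forall>q. q \<notin> E \<longrightarrow> s q = 0 \<and> tame F (\<phi> q) q)"
    using assms by (simp add: admissible_def)
  then show ?thesis using that by (elim exE conjE) simp
qed

text \<open>New exceptional points are those of the right factor, the preimages of those of the left
  factor, and the overlaps. Elsewhere both functions are powers of one element, so the exponents
  add.\<close>

lemma admissible_comp:
  assumes "admissible \<pi> c r s \<phi>" "admissible \<rho> d t u \<psi>"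
  shows "admissible (\<pi> \<circ> \<rho>) (c * d) (c *\<^sub>R t + r) (\<lambda>q. u q + s (d *\<^sub>R q + t))
      (\<lambda>q n. \<phi> (d *\<^sub>R q + t) (n + u q) \<otimes> \<psi> q n)"
proof -
  obtain E F where EF: "finite E" "finite F" "fst ` F \<subseteq> - {0}"
    "\<And>q. q \<notin> E \<Longrightarrow> s q = 0" "\<And>q. q \<notin> E \<Longrightarrow> tame F (\<phi> q) q"
    using admissibleE[OF assms(1)] by metis
  obtain E' F' where EF': "finite E'" "finite F'" "fst ` F' \<subseteq> - {0}"
    "\<And>q. q \<notin> E' \<Longrightarrow> u q = 0" "\<And>q. q \<notin> E' \<Longrightarrow> tame F' (\<psi> q) q"
    using admissibleE[OF assms(2)] by metis
  have d: "d \<noteq> 0" and cl: "\<And>q n. \<phi> q n \<in> carrier H" "\<And>q n. \<psi> q n \<in> carrier H"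
    using assms by (auto simp: admissible_def)
  define A where "A q = d *\<^sub>R q + t" for q
  \<comment> \<open>An affine map evaluated at \<open>A q\<close> is rewritten as an affine map
    evaluated at \<open>q\<close>.\<close>
  define F1 where "F1 = (\<lambda>a. (fst a * d, fst a *\<^sub>R t + snd a)) ` F"
  define E1 where "E1 = E' \<union> A -` E \<union> overlap F1 F'"
  have "inj A" using d by (simp add: inj_def A_def)
  then have "finite (A -` E)" using EF(1) by (simp add: finite_vimageI)
  moreover have F1: "finite F1" "fst ` F1 \<subseteq> - {0}" using EF(2,3) d by (auto simp: F1_def)
  ultimately have "finite E1" using EF' finite_overlap by (simp add: E1_def)
  moreover have "u q + s (A q) = 0 \<and> tame (F1 \<union> F') (\<lambda>n. \<phi> (A q) (n + u q) \<otimes> \<psi> q n) q"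
    if q: "q \<notin> E1" for q
  proof -
    have q': "q \<notin> E'" "A q \<notin> E" "q \<notin> overlap F1 F'" using q by (auto simp: E1_def)
    have "tame F (\<phi> (A q)) (A q)" by (rule EF(5)[OF q'(2)])
    then obtain a k where a: "a \<in> F"
      "\<And>n. \<phi> (A q) n = (if 0 \<le> n then f (fst a *\<^sub>R A q + snd a) [^] (k::int) else \<one>)"
      unfolding tame_def by metis
    have "fst a *\<^sub>R A q + snd a = (fst a * d) *\<^sub>R q + (fst a *\<^sub>R t + snd a)"
      by (simp add: A_def scaleR_add_right)
    then have "tame F1 (\<phi> (A q)) q"
      using a unfolding tame_def F1_def
      by (intro bexI[of _ "(fst a * d, fst a *\<^sub>R t + snd a)"] exI[of _ k])
         (auto simp: add.assoc)
    from tame_common[OF this EF'(5)[OF q'(1)] q'(3)]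
    obtain a i j where *: "a \<in> F1 \<union> F'"
      "\<And>n. \<phi> (A q) n = (if 0 \<le> n then f (fst a *\<^sub>R q + snd a) [^] (i::int) else \<one>)"
      "\<And>n. \<psi> q n = (if 0 \<le> n then f (fst a *\<^sub>R q + snd a) [^] (j::int) else \<one>)"
      by metis
    \<comment> \<open>Outside \<open>E'\<close> the shift \<open>u q\<close> is zero, so both
      functions jump at the same level \<open>n = 0\<close>.\<close>
    have "\<phi> (A q) (n + u q) \<otimes> \<psi> q n = (if 0 \<le> n then f (fst a *\<^sub>R q + snd a) [^] (i + j) else \<one>)" for n
      using * EF'(4)[OF q'(1)] by (simp add: int_pow_mult)
    then have "tame (F1 \<union> F') (\<lambda>n. \<phi> (A q) (n + u q) \<otimes> \<psi> q n) q"
      using *(1) unfolding tame_def by blast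
    then show ?thesis using EF(4)[OF q'(2)] EF'(4)[OF q'(1)] by simp
  qed
  moreover have "ev_const (\<lambda>n. \<phi> (A q) (n + u q) \<otimes> \<psi> q n)" for q
    using assms by (intro ev_const_mult) (auto simp: admissible_def)
  moreover have "\<pi> \<circ> \<rho> = act (c * d) (c *\<^sub>R t + r) (\<lambda>q. u q + s (A q))
      (\<lambda>q n. \<phi> (A q) (n + u q) \<otimes> \<psi> q n)"
    using assms by (simp add: admissible_def act_comp A_def)
  moreover have "finite (F1 \<union> F')" "fst ` (F1 \<union> F') \<subseteq> - {0}" using F1 EF' by auto
  moreover have "c * d \<noteq> 0" using assms by (simp add: admissible_def)
  ultimately show ?thesis
    unfolding admissible_def A_def[symmetric] using cl
    by (intro conjI allI exI[of _ E1] exI[of _ "F1 \<union> F'"] impI m_closed) simp_all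
qed

lemma admissible_affine_shift:
  assumes "c \<noteq> 0" "finite {q. s q \<noteq> 0}"
  shows "admissible (act c r s (\<lambda>_ _. \<one>)) c r s (\<lambda>_ _. \<one>)"
proof -
  have "tame {(1, 0)} (\<lambda>_. \<one>) q" for q
    unfolding tame_def by (intro bexI[of _ "(1, 0)"] exI[of _ 0]) auto
  moreover have "ev_const (\<lambda>_. \<one>)" by (auto simp: ev_const_def)
  ultimately show ?thesis
    unfolding admissible_def using assms
    by (auto intro!: exI[of _ "{q. s q \<noteq> 0}"] exI[of _ "{(1, 0)}"])
qed

text \<open>The exponents 1, -1 and 0 cover the permutation part of \<open>mover\<close>, its
  inverse, and the identity, which is the permutation part of \<open>counter\<close>.\<close>

abbreviation "mover_pow k \<equiv> act 1 0 (\<lambda>_. 0) (\<lambda>q n. if 0 \<le> n then f q [^] (k::int) else \<one>)"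

lemma admissible_mover_pow:
  "admissible (mover_pow k) 1 0 (\<lambda>_. 0) (\<lambda>q n. if 0 \<le> n then f q [^] k else \<one>)"
proof -
  have "tame {(1, 0)} (\<lambda>n. if 0 \<le> n then f q [^] k else \<one>) q" for q
    unfolding tame_def by (intro bexI[of _ "(1, 0)"] exI[of _ k]) auto
  moreover have "ev_const (\<lambda>n. if 0 \<le> n then f q [^] k else \<one>)" for q
    unfolding ev_const_def by (intro exI[of _ 1] exI[of _ "f q [^] k"]) auto
  ultimately show ?thesis
    unfolding admissible_def by (auto intro!: exI[of _ "{}"] exI[of _ "{(1, 0)}"])
qed

lemma mover_pow_0: "mover_pow 0 = id"
proof -
  have "(\<lambda>q n. if 0 \<le> n then f q [^] (0::int) else \<one>) = (\<lambda>(q::complex) (n::int). \<one>)"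
    by (simp add: fun_eq_iff)
  then show ?thesis by (simp only: act_id)
qed

lemma fst_inv_eq:
  assumes "g \<in> carrier cocycle_group" "fst g \<circ> \<rho> = id"
  shows "fst (inv\<^bsub>cocycle_group\<^esub> g) = \<rho>"
proof -
  have "fst (inv\<^bsub>cocycle_group\<^esub> g \<otimes>\<^bsub>cocycle_group\<^esub> g) = id"
    using cocycle.l_inv[OF assms(1)] by simp
  then have "fst (inv\<^bsub>cocycle_group\<^esub> g) \<circ> fst g = id" by simp
  then show ?thesis using assms(2) by (metis comp_assoc comp_id id_comp)
qed

text \<open>\<open>generate\<close> inverts generators only, so no general closure of admissibility
  under inverses is required.\<close>

lemma admissible_inv_gens:
  assumes "g \<in> gens"
  shows "\<exists>c r s \<phi>. admissible (fst g) c r s \<phi>" "\<exists>c r s \<phi>. admissible (fst (inv\<^bsub>cocycle_group\<^esub> g)) c r s \<phi>"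
proof -
  have g: "g \<in> carrier cocycle_group" using assms gens_carrier by blast
  consider (aff) c r where "c \<noteq> 0" "g = aff c r" | (shift) "g = shift" | (mover) "g = mover"
    | (counter) "g = counter"
  proof -
    have "(2::real) \<noteq> 0" "(1::real) \<noteq> 0" by auto
    then show thesis
      using assms aff shift mover counter unfolding gens_def by (elim insertE emptyE) metis+
  qed
  then have "\<exists>\<rho>. fst g \<circ> \<rho> = id \<and> (\<exists>c r s \<phi>. admissible (fst g) c r s \<phi>) \<and> (\<exists>c r s \<phi>. admissible \<rho> c r s \<phi>)"
  proof cases
    case aff
    have "fst g \<circ> act (1 / c) (- ((1 / c) *\<^sub>R r)) (\<lambda>_. 0) (\<lambda>_ _. \<one>) = id"
      using aff by (simp add: aff_def act_comp act_id[symmetric])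
    moreover have "admissible (fst g) c r (\<lambda>_. 0) (\<lambda>_ _. \<one>)"
      using admissible_affine_shift[of c "\<lambda>_. 0"] aff by (simp add: aff_def)
    moreover have "admissible (act (1 / c) (- ((1 / c) *\<^sub>R r)) (\<lambda>_. 0) (\<lambda>_ _. \<one>))
        (1 / c) (- ((1 / c) *\<^sub>R r)) (\<lambda>_. 0) (\<lambda>_ _. \<one>)"
      using admissible_affine_shift[of "1 / c" "\<lambda>_. 0"] aff by simp
    ultimately show ?thesis by blast
  next
    case shift
    let ?\<rho> = "\<lambda>k. act 1 0 (\<lambda>q. if q = 0 then k else 0) (\<lambda>_ _. \<one>)"
    have "fst g = ?\<rho> 1" by (simp add: shift shift_def)
    moreover have "?\<rho> 1 \<circ> ?\<rho> (- 1) = id"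
      by (auto simp: act_comp act_id[symmetric] cong: if_cong intro!: arg_cong2[where f = "act 1 0"])
    moreover have "admissible (?\<rho> k) 1 0 (\<lambda>q. if q = 0 then k else 0) (\<lambda>_ _. \<one>)" for k
      by (rule admissible_affine_shift) auto
    ultimately show ?thesis by metis
  next
    case mover
    have "fst g = mover_pow 1" by (simp add: mover mover_def cong: if_cong)
    moreover have "mover_pow 1 \<circ> mover_pow (- 1) = id"
      by (auto simp: fun_eq_iff act_simp int_pow_neg m_assoc[symmetric])
    ultimately show ?thesis using admissible_mover_pow by metis
  next
    case counter
    then have "fst g = mover_pow 0" by (simp add: fst_counter mover_pow_0)
    moreover have "mover_pow 0 \<circ> mover_pow 0 = id" by (simp add: mover_pow_0)
    ultimately show ?thesis using admissible_mover_pow by metis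
  qed
  then show "\<exists>c r s \<phi>. admissible (fst g) c r s \<phi>" "\<exists>c r s \<phi>. admissible (fst (inv\<^bsub>cocycle_group\<^esub> g)) c r s \<phi>"
    using fst_inv_eq[OF g] by metis+
qed

lemma admissible_generate:
  assumes "g \<in> generate cocycle_group gens"
  shows "\<exists>c r s \<phi>. admissible (fst g) c r s \<phi>"
  using assms
proof induction
  case one
  have "mover_pow 0 = fst \<one>\<^bsub>cocycle_group\<^esub>" by (simp add: mover_pow_0)
  then show ?case using admissible_mover_pow[of 0] by metis
next
  case (eng g h)
  obtain c r s \<phi> where "admissible (fst g) c r s \<phi>" using eng.IH(1) by (elim exE)
  moreover obtain d t u \<psi> where "admissible (fst h) d t u \<psi>" using eng.IH(2) by (elim exE)
  ultimately show ?case unfolding cocycle_group_simps by (intro exI) (rule admissible_comp)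
next
  case (incl h)
  then show ?case by (rule admissible_inv_gens)
next
  case (inv h)
  then show ?case by (rule admissible_inv_gens)
qed

end

section \<open>The normal series\<close>

text \<open>\<open>G\<close> is an isomorphic copy of the generated group on an arbitrary type, seen
  through \<open>\<rho>\<close>. The normal series is thus built directly in the copy.\<close>

locale realization = weighted_group H l \<nu> + G: group G
  for H :: "('a, 'b) monoid_scheme" (structure) and l \<nu> and G :: "('g, 'c) monoid_scheme" +
  fixes \<rho> :: "'g \<Rightarrow> (complex \<times> int \<times> 'a \<Rightarrow> complex \<times> int \<times> 'a) \<times> (complex \<times> int \<times> 'a \<Rightarrow> real)"
  assumes \<rho>_hom: "\<rho> \<in> hom G cocycle_group"
    and \<rho>_inj: "inj_on \<rho> (carrier G)"
    and \<rho>_image: "\<rho> ` carrier G = generate cocycle_group gens"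
begin

abbreviation "p g \<equiv> fst (\<rho> g)"

lemma p_mult: "g \<in> carrier G \<Longrightarrow> h \<in> carrier G \<Longrightarrow> p (g \<otimes>\<^bsub>G\<^esub> h) = p g \<circ> p h"
  using \<rho>_hom by (simp add: hom_mult)

lemma p_one: "p \<one>\<^bsub>G\<^esub> = id"
  using hom_one[OF \<rho>_hom G.is_group cocycle.is_group] by simp

lemma p_inv1: "g \<in> carrier G \<Longrightarrow> p (inv\<^bsub>G\<^esub> g) (p g z) = z"
  using p_mult[of "inv\<^bsub>G\<^esub> g" g] p_one by (simp add: fun_eq_iff del: cocycle_group_simps split_paired_All)

lemma p_inv2: "g \<in> carrier G \<Longrightarrow> p g (p (inv\<^bsub>G\<^esub> g) z) = z"
  using p_mult[of g "inv\<^bsub>G\<^esub> g"] p_one by (simp add: fun_eq_iff del: cocycle_group_simps split_paired_All)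

lemma p_admissible:
  assumes "g \<in> carrier G"
  obtains c r s \<phi> where "admissible (p g) c r s \<phi>"
proof -
  have "\<rho> g \<in> generate cocycle_group gens" using assms \<rho>_image by blast
  then have "\<exists>c r s \<phi>. admissible (p g) c r s \<phi>" by (rule admissible_generate)
  then show ?thesis using that by (elim exE)
qed

lemma admissibleD: "admissible \<pi> c r s \<phi> \<Longrightarrow> \<pi> = act c r s \<phi>" "admissible \<pi> c r s \<phi> \<Longrightarrow> c \<noteq> 0"
    "admissible \<pi> c r s \<phi> \<Longrightarrow> \<phi> q n \<in> carrier H" "admissible \<pi> c r s \<phi> \<Longrightarrow> ev_const (\<phi> q)"
  by (simp_all add: admissible_def)

definition G1 where "G1 = {g \<in> carrier G. p g = id}"

definition vertical :: "(complex \<times> int \<times> 'a \<Rightarrow> complex \<times> int \<times> 'a) \<Rightarrow> bool" where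
  "vertical \<pi> \<longleftrightarrow> (\<forall>z. fst (\<pi> z) = fst z \<and> fst (snd (\<pi> z)) = fst (snd z))"

definition G2 where "G2 = {g \<in> carrier G. vertical (p g) \<and> finite {fst z | z. p g z \<noteq> z}}"

lemma verticalD: "vertical \<pi> \<Longrightarrow> fst (\<pi> z) = fst z" "vertical \<pi> \<Longrightarrow> fst (snd (\<pi> z)) = fst (snd z)"
  unfolding vertical_def by blast+

lemma subgroup_G1: "subgroup G1 G"
proof (rule G.subgroupI)
  show "G1 \<subseteq> carrier G" by (auto simp: G1_def)
  show "G1 \<noteq> {}" using p_one by (auto simp: G1_def)
next
  fix g assume g: "g \<in> G1"
  have "p (inv\<^bsub>G\<^esub> g) z = z" for z
    using p_inv1[of g z] g by (simp add: G1_def)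
  then show "inv\<^bsub>G\<^esub> g \<in> G1" using g by (simp add: G1_def fun_eq_iff)
next
  fix g h assume "g \<in> G1" "h \<in> G1"
  then show "g \<otimes>\<^bsub>G\<^esub> h \<in> G1" by (simp add: G1_def p_mult)
qed

lemma normal_G1: "G1 \<lhd> G"
  unfolding G.normal_inv_iff
proof (intro conjI ballI subgroup_G1)
  fix g h assume "g \<in> carrier G" "h \<in> G1"
  then show "g \<otimes>\<^bsub>G\<^esub> h \<otimes>\<^bsub>G\<^esub> inv\<^bsub>G\<^esub> g \<in> G1"
    by (simp add: G1_def p_mult p_inv2 fun_eq_iff del: split_paired_All)
qed

text \<open>Over identity permutations the cocycles simply add pointwise, and \<open>\<rho>\<close>
  is injective.\<close>

lemma comm_group_G1: "comm_group (G\<lparr>carrier := G1\<rparr>)"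
proof (rule group.group_comm_groupI)
  show "group (G\<lparr>carrier := G1\<rparr>)" using subgroup_G1 by (rule G.subgroup_imp_group)
next
  fix g h assume "g \<in> carrier (G\<lparr>carrier := G1\<rparr>)" "h \<in> carrier (G\<lparr>carrier := G1\<rparr>)"
  then have gh: "g \<in> carrier G" "h \<in> carrier G" "p g = id" "p h = id" by (auto simp: G1_def)
  have "\<rho> (g \<otimes>\<^bsub>G\<^esub> h) = \<rho> (h \<otimes>\<^bsub>G\<^esub> g)"
  proof (rule prod_eqI)
    show "snd (\<rho> (g \<otimes>\<^bsub>G\<^esub> h)) = snd (\<rho> (h \<otimes>\<^bsub>G\<^esub> g))"
      using gh by (intro ext) (simp add: hom_mult[OF \<rho>_hom])
  qed (use gh p_mult in simp)
  then show "g \<otimes>\<^bsub>G\<lparr>carrier := G1\<rparr>\<^esub> h = h \<otimes>\<^bsub>G\<lparr>carrier := G1\<rparr>\<^esub> g"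
    using inj_onD[OF \<rho>_inj] gh by simp
qed

lemma subgroup_G2: "subgroup G2 G"
proof (rule G.subgroupI)
  show "G2 \<subseteq> carrier G" by (auto simp: G2_def)
  show "G2 \<noteq> {}" using p_one by (auto simp: G2_def vertical_def)
next
  fix g assume g: "g \<in> G2"
  then have gc: "g \<in> carrier G" and v: "vertical (p g)" by (auto simp: G2_def)
  have "vertical (p (inv\<^bsub>G\<^esub> g))"
    unfolding vertical_def using verticalD[OF v] p_inv2[OF gc] by metis
  moreover have "{fst z | z. p (inv\<^bsub>G\<^esub> g) z \<noteq> z} \<subseteq> {fst z | z. p g z \<noteq> z}"
  proof
    fix q assume "q \<in> {fst z | z. p (inv\<^bsub>G\<^esub> g) z \<noteq> z}"
    then obtain z where z: "q = fst z" "p (inv\<^bsub>G\<^esub> g) z \<noteq> z" by blast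
    then have "p g z \<noteq> z" using p_inv1[OF gc, of z] by metis
    with z(1) show "q \<in> {fst z | z. p g z \<noteq> z}" by blast
  qed
  then have "finite {fst z | z. p (inv\<^bsub>G\<^esub> g) z \<noteq> z}"
    using g unfolding G2_def by (blast intro: finite_subset)
  ultimately show "inv\<^bsub>G\<^esub> g \<in> G2"
    using gc by (simp add: G2_def)
next
  fix g h assume gh: "g \<in> G2" "h \<in> G2"
  have "{fst z | z. p g (p h z) \<noteq> z} \<subseteq> {fst z | z. p g z \<noteq> z} \<union> {fst z | z. p h z \<noteq> z}"
  proof
    fix q assume "q \<in> {fst z | z. p g (p h z) \<noteq> z}"
    then obtain z where z: "q = fst z" "p g (p h z) \<noteq> z" by blast
    then have "p h z \<noteq> z \<or> p g z \<noteq> z" by metis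
    with z(1) show "q \<in> {fst z | z. p g z \<noteq> z} \<union> {fst z | z. p h z \<noteq> z}" by blast
  qed
  moreover have "finite ({fst z | z. p g z \<noteq> z} \<union> {fst z | z. p h z \<noteq> z})"
    using gh unfolding G2_def by blast
  ultimately have "finite {fst z | z. p g (p h z) \<noteq> z}" by (rule finite_subset)
  moreover have "vertical (p g \<circ> p h)"
    using gh by (simp add: vertical_def G2_def del: split_paired_All)
  ultimately show "g \<otimes>\<^bsub>G\<^esub> h \<in> G2"
    using gh by (simp add: G2_def p_mult)
qed

text \<open>Conjugation by \<open>g\<close> moves the support by the affine map of \<open>g\<close>.
  Since \<open>g\<close> maps fibres over \<open>(q, n)\<close> to such fibres, verticality
  survives.\<close>

lemma normal_G2: "G2 \<lhd> G"
  unfolding G.normal_inv_iff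
proof (intro conjI ballI subgroup_G2)
  fix g h assume g: "g \<in> carrier G" and "h \<in> G2"
  then have h: "h \<in> carrier G" "vertical (p h)" "finite {fst z | z. p h z \<noteq> z}"
    by (auto simp: G2_def)
  obtain c r s \<phi> where gd: "admissible (p g) c r s \<phi>" using p_admissible[OF g] .
  then have pg: "p g = act c r s \<phi>" by (rule admissibleD)
  let ?k = "g \<otimes>\<^bsub>G\<^esub> h \<otimes>\<^bsub>G\<^esub> inv\<^bsub>G\<^esub> g"
  have k: "?k \<in> carrier G" "p ?k z = p g (p h (p (inv\<^bsub>G\<^esub> g) z))" for z
    using g h by (simp_all add: p_mult)
  have fib: "fst (p g y) = fst (p g z) \<and> fst (snd (p g y)) = fst (snd (p g z))"
    if "fst y = fst z" "fst (snd y) = fst (snd z)" for y z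
    using that by (cases y, cases z) (simp add: pg act_simp)
  have "vertical (p ?k)"
    unfolding vertical_def k(2)
    using fib[OF verticalD[OF h(2)]] p_inv2[OF g] by simp
  moreover have "{fst z | z. p ?k z \<noteq> z} \<subseteq> (\<lambda>q. c *\<^sub>R q + r) ` {fst z | z. p h z \<noteq> z}"
  proof clarify
    fix z assume ne: "p ?k z \<noteq> z"
    define y where "y = p (inv\<^bsub>G\<^esub> g) z"
    have z: "z = p g y" using p_inv2[OF g] by (simp add: y_def)
    have "p ?k z = p g (p h y)" by (simp only: k(2) y_def)
    then have "p h y \<noteq> y" using ne z by metis
    moreover have "fst z = c *\<^sub>R fst y + r" unfolding z pg by (cases y) (simp add: act_simp)
    ultimately show "fst z \<in> (\<lambda>q. c *\<^sub>R q + r) ` {fst z | z. p h z \<noteq> z}" by blast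
  qed
  then have "finite {fst z | z. p ?k z \<noteq> z}"
    using h(3) by (meson finite_imageI finite_subset)
  ultimately show "?k \<in> G2" using k(1) by (simp add: G2_def)
qed

lemma G1_subset_G2: "G1 \<subseteq> G2"
  by (auto simp: G1_def G2_def vertical_def)

section \<open>The derived series: pure translations of \<open>q\<close> in \<open>D1\<close>,
  trivial action on \<open>q\<close> in \<open>D2\<close>\<close>

definition D1 where "D1 = {g \<in> carrier G. \<exists>r. \<forall>z. fst (p g z) = fst z + r}"
definition D2 where "D2 = {g \<in> carrier G. \<forall>z. fst (p g z) = fst z}"

lemma subgroup_D1: "subgroup D1 G"
proof (rule G.subgroupI)
  show "D1 \<subseteq> carrier G" by (auto simp: D1_def)
  show "D1 \<noteq> {}" using p_one by (auto simp: D1_def intro!: exI[of _ "\<one>\<^bsub>G\<^esub>"])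
next
  fix g assume "g \<in> D1"
  then obtain r where g: "g \<in> carrier G" "\<And>z. fst (p g z) = fst z + r" by (auto simp: D1_def)
  have "fst (p (inv\<^bsub>G\<^esub> g) z) = fst z + (- r)" for z
    using g(2)[of "p (inv\<^bsub>G\<^esub> g) z"] p_inv2[OF g(1)] by simp
  with g(1) show "inv\<^bsub>G\<^esub> g \<in> D1" unfolding D1_def by blast
next
  fix g h assume "g \<in> D1" "h \<in> D1"
  then obtain r t where g: "g \<in> carrier G" "\<And>z. fst (p g z) = fst z + r"
    and h: "h \<in> carrier G" "\<And>z. fst (p h z) = fst z + t" by (auto simp: D1_def)
  have "fst (p (g \<otimes>\<^bsub>G\<^esub> h) z) = fst z + (t + r)" for z
    using g h by (simp add: p_mult)
  with g(1) h(1) show "g \<otimes>\<^bsub>G\<^esub> h \<in> D1" unfolding D1_def by blast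
qed

lemma subgroup_D2: "subgroup D2 G"
proof (rule G.subgroupI)
  show "D2 \<subseteq> carrier G" by (auto simp: D2_def)
  show "D2 \<noteq> {}" using p_one by (auto simp: D2_def intro!: exI[of _ "\<one>\<^bsub>G\<^esub>"])
next
  fix g assume "g \<in> D2"
  then have g: "g \<in> carrier G" "\<And>z. fst (p g z) = fst z" by (auto simp: D2_def)
  have "fst (p (inv\<^bsub>G\<^esub> g) z) = fst z" for z
    using g(2)[of "p (inv\<^bsub>G\<^esub> g) z"] p_inv2[OF g(1)] by simp
  with g(1) show "inv\<^bsub>G\<^esub> g \<in> D2" by (simp add: D2_def)
next
  fix g h assume "g \<in> D2" "h \<in> D2"
  then show "g \<otimes>\<^bsub>G\<^esub> h \<in> D2" by (simp add: D2_def p_mult del: split_paired_All)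
qed

text \<open>With \<open>y\<close> the image of \<open>z\<close> under the inverse of
  \<open>h\<close> followed by that of \<open>g\<close>, the commutator sends the
  \<open>hg\<close>-image of \<open>y\<close> to its \<open>gh\<close>-image. Only these two
  products need comparing.\<close>

lemma commutator:
  assumes "g \<in> carrier G" "h \<in> carrier G"
  shows "g \<otimes>\<^bsub>G\<^esub> h \<otimes>\<^bsub>G\<^esub> inv\<^bsub>G\<^esub> g \<otimes>\<^bsub>G\<^esub> inv\<^bsub>G\<^esub> h \<in> carrier G"
    and "\<exists>y. z = p h (p g y) \<and> p (g \<otimes>\<^bsub>G\<^esub> h \<otimes>\<^bsub>G\<^esub> inv\<^bsub>G\<^esub> g \<otimes>\<^bsub>G\<^esub> inv\<^bsub>G\<^esub> h) z = p g (p h y)"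
  using assms
  by (auto simp: p_mult p_inv1 p_inv2 intro!: exI[of _ "p (inv\<^bsub>G\<^esub> g) (p (inv\<^bsub>G\<^esub> h) z)"] simp del: split_paired_Ex)

lemma p_affine:
  assumes "g \<in> carrier G"
  shows "\<exists>c r. \<forall>z. fst (p g z) = c *\<^sub>R fst z + r"
proof -
  obtain c r s \<phi> where "admissible (p g) c r s \<phi>" using p_admissible[OF assms] .
  then have pg: "p g = act c r s \<phi>" by (rule admissibleD)
  have "fst (p g z) = c *\<^sub>R fst z + r" for z unfolding pg by (cases z) (simp add: act_simp)
  then show ?thesis by blast
qed

text \<open>The ratios are real numbers and commute, so only a translation remains.\<close>

lemma commutator_D1:
  assumes "g \<in> carrier G" "h \<in> carrier G"
  shows "g \<otimes>\<^bsub>G\<^esub> h \<otimes>\<^bsub>G\<^esub> inv\<^bsub>G\<^esub> g \<otimes>\<^bsub>G\<^esub> inv\<^bsub>G\<^esub> h \<in> D1"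
proof -
  obtain c r where g: "\<And>z. fst (p g z) = c *\<^sub>R fst z + r" using p_affine[OF assms(1)] by metis
  obtain d t where h: "\<And>z. fst (p h z) = d *\<^sub>R fst z + t" using p_affine[OF assms(2)] by metis
  have "fst (p (g \<otimes>\<^bsub>G\<^esub> h \<otimes>\<^bsub>G\<^esub> inv\<^bsub>G\<^esub> g \<otimes>\<^bsub>G\<^esub> inv\<^bsub>G\<^esub> h) z) = fst z + (c *\<^sub>R t + r - d *\<^sub>R r - t)" for z
    using commutator(2)[OF assms, of z] by (auto simp: g h scaleR_add_right)
  then show ?thesis using commutator(1)[OF assms] unfolding D1_def by blast
qed

lemma commutator_D2:
  assumes "g \<in> D1" "h \<in> D1"
  shows "g \<otimes>\<^bsub>G\<^esub> h \<otimes>\<^bsub>G\<^esub> inv\<^bsub>G\<^esub> g \<otimes>\<^bsub>G\<^esub> inv\<^bsub>G\<^esub> h \<in> D2"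
proof -
  obtain r t where g: "g \<in> carrier G" "\<And>z. fst (p g z) = fst z + r"
    and h: "h \<in> carrier G" "\<And>z. fst (p h z) = fst z + t" using assms by (auto simp: D1_def)
  have "fst (p (g \<otimes>\<^bsub>G\<^esub> h \<otimes>\<^bsub>G\<^esub> inv\<^bsub>G\<^esub> g \<otimes>\<^bsub>G\<^esub> inv\<^bsub>G\<^esub> h) z) = fst z" for z
    using commutator(2)[OF g(1) h(1), of z] by (auto simp: g h)
  then show ?thesis using commutator(1)[OF g(1) h(1)] unfolding D2_def by blast
qed

lemma D2_act:
  assumes "g \<in> D2"
  obtains s \<phi> where "admissible (p g) 1 0 s \<phi>"
proof -
  have g: "g \<in> carrier G" "\<And>z. fst (p g z) = fst z" using assms by (auto simp: D2_def)
  obtain c r s \<phi> where gd: "admissible (p g) c r s \<phi>" using p_admissible[OF g(1)] .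
  then have pg: "p g = act c r s \<phi>" by (rule admissibleD)
  have "r = 0" using g(2)[of "(0, 0, \<one>)"] by (simp add: pg act_simp)
  moreover have "c = 1" using g(2)[of "(1, 0, \<one>)"] \<open>r = 0\<close> by (simp add: pg act_simp scaleR_conv_of_real)
  ultimately show ?thesis using gd that by simp
qed

text \<open>Outside a finite set of \<open>q\<close> both elements act by powers of one element of
  \<open>H\<close> and without shift, hence commute there.\<close>

lemma commutator_G2:
  assumes "g \<in> D2" "h \<in> D2"
  shows "g \<otimes>\<^bsub>G\<^esub> h \<otimes>\<^bsub>G\<^esub> inv\<^bsub>G\<^esub> g \<otimes>\<^bsub>G\<^esub> inv\<^bsub>G\<^esub> h \<in> G2"
proof -
  let ?k = "g \<otimes>\<^bsub>G\<^esub> h \<otimes>\<^bsub>G\<^esub> inv\<^bsub>G\<^esub> g \<otimes>\<^bsub>G\<^esub> inv\<^bsub>G\<^esub> h"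
  have gh: "g \<in> carrier G" "h \<in> carrier G" using assms by (auto simp: D2_def)
  obtain s \<phi> where g: "admissible (p g) 1 0 s \<phi>" using D2_act[OF assms(1)] .
  obtain u \<psi> where h: "admissible (p h) 1 0 u \<psi>" using D2_act[OF assms(2)] .
  note pg = admissibleD(1)[OF g] and ph = admissibleD(1)[OF h]
  obtain E F where E: "finite E" "finite F" "fst ` F \<subseteq> - {0}"
    "\<And>q. q \<notin> E \<Longrightarrow> s q = 0" "\<And>q. q \<notin> E \<Longrightarrow> tame F (\<phi> q) q"
    using admissibleE[OF g] by metis
  obtain E' F' where E': "finite E'" "finite F'" "fst ` F' \<subseteq> - {0}"
    "\<And>q. q \<notin> E' \<Longrightarrow> u q = 0" "\<And>q. q \<notin> E' \<Longrightarrow> tame F' (\<psi> q) q"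
    using admissibleE[OF h] by metis
  have comm: "p g (p h (q, n, x)) = p h (p g (q, n, x))" if "q \<notin> E \<union> E' \<union> overlap F F'" for q n x
  proof -
    have q: "q \<notin> E" "q \<notin> E'" "q \<notin> overlap F F'" using that by auto
    obtain a i j where *:
      "\<And>n. \<phi> q n = (if 0 \<le> n then f (fst a *\<^sub>R q + snd a) [^] (i::int) else \<one>)"
      "\<And>n. \<psi> q n = (if 0 \<le> n then f (fst a *\<^sub>R q + snd a) [^] (j::int) else \<one>)"
      using tame_common[OF E(5)[OF q(1)] E'(5)[OF q(2)] q(3)] by metis
    have "\<phi> q n \<otimes> \<psi> q n = \<psi> q n \<otimes> \<phi> q n"
      using * comm_int_pow_mult by simp
    then show ?thesis
      using admissibleD(3)[OF g] admissibleD(3)[OF h] E(4)[OF q(1)] E'(4)[OF q(2)]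
      by (simp add: pg ph act_simp m_assoc[symmetric])
  qed
  \<comment> \<open>Even over exceptional \<open>q\<close> the shifts add in either order, because
    both elements fix \<open>q\<close>; so the commutator is vertical everywhere.\<close>
  have fst_hg: "fst (p h (p g y)) = fst y" "fst (p g (p h y)) = fst y"
    "fst (snd (p h (p g y))) = fst (snd y) + s (fst y) + u (fst y)"
    "fst (snd (p g (p h y))) = fst (snd y) + s (fst y) + u (fst y)" for y
    unfolding pg ph by (cases y; simp add: act_simp)+
  have "vertical (p ?k)"
    unfolding vertical_def using commutator(2)[OF gh] fst_hg by metis
  moreover have "{fst z | z. p ?k z \<noteq> z} \<subseteq> E \<union> E' \<union> overlap F F'"
  proof (intro subsetI, rule ccontr)
    fix q assume "q \<in> {fst z | z. p ?k z \<noteq> z}" and q: "q \<notin> E \<union> E' \<union> overlap F F'"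
    then obtain z where ne: "p ?k z \<noteq> z" and z: "fst z \<notin> E \<union> E' \<union> overlap F F'" by blast
    obtain y where y: "z = p h (p g y)" "p ?k z = p g (p h y)" using commutator(2)[OF gh] by blast
    have "fst y \<notin> E \<union> E' \<union> overlap F F'" using z fst_hg(1) y(1) by metis
    then have "p g (p h y) = p h (p g y)" using comm by (cases y) simp
    with ne y show False by simp
  qed
  moreover have "finite (E \<union> E' \<union> overlap F F')"
    using E(1-3) E'(1-3) by (intro finite_UnI finite_overlap)
  ultimately have "finite {fst z | z. p ?k z \<noteq> z}" by (meson finite_subset)
  with \<open>vertical (p ?k)\<close> show ?thesis
    using commutator(1)[OF gh] by (simp add: G2_def)
qed

lemma derived_G: "(derived G ^^ 3) (carrier G) \<subseteq> G2"
proof -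
  have "derived G (carrier G) \<subseteq> D1"
    by (rule G.derived_subset_subgroup[OF subgroup_D1 commutator_D1])
  then have "derived G (derived G (carrier G)) \<subseteq> derived G D1" by (rule G.mono_derived)
  also have "\<dots> \<subseteq> D2" by (rule G.derived_subset_subgroup[OF subgroup_D2 commutator_D2])
  finally have "derived G (derived G (derived G (carrier G))) \<subseteq> derived G D2" by (rule G.mono_derived)
  also have "\<dots> \<subseteq> G2" by (rule G.derived_subset_subgroup[OF subgroup_G2 commutator_G2])
  finally show ?thesis by (simp add: numeral_3_eq_3)
qed

section \<open>Coordinates of \<open>G2\<close> with values in \<open>H\<close>\<close>

definition coord :: "'g \<Rightarrow> complex \<times> int \<Rightarrow> 'a" where
  "coord g = (\<lambda>(q, n). snd (snd (p g (q, n, \<one>))))"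

text \<open>Verticality removes the affine part and the shift. What remains is left multiplication,
  whose factor is visible at the identity.\<close>

lemma G2_act:
  assumes "g \<in> G2"
  shows "p g = act 1 0 (\<lambda>_. 0) (\<lambda>q n. coord g (q, n))"
    and "coord g i \<in> carrier H"
    and "ev_const (\<lambda>n. coord g (q, n))"
    and "finite {q. \<exists>n. coord g (q, n) \<noteq> \<one>}"
proof -
  have g: "g \<in> carrier G" "vertical (p g)" "finite {fst z | z. p g z \<noteq> z}"
    using assms by (auto simp: G2_def)
  have "g \<in> D2" using g verticalD by (auto simp: D2_def)
  then obtain s \<phi> where gd: "admissible (p g) 1 0 s \<phi>" using D2_act by blast
  have s: "s = (\<lambda>_. 0)"
  proof
    fix q show "s q = 0"
      using verticalD(2)[OF g(2), of "(q, 0, \<one>)"] by (simp add: admissibleD(1)[OF gd] act_simp)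
  qed
  have cl: "\<phi> q n \<in> carrier H" for q n using admissibleD(3)[OF gd] .
  have co: "coord g (q, n) = \<phi> q n" for q n
    using cl by (simp add: coord_def admissibleD(1)[OF gd] act_simp)
  show pg: "p g = act 1 0 (\<lambda>_. 0) (\<lambda>q n. coord g (q, n))"
    using admissibleD(1)[OF gd] by (simp add: co s)
  show "coord g i \<in> carrier H" using cl co by (cases i) simp
  show "ev_const (\<lambda>n. coord g (q, n))" using admissibleD(4)[OF gd] by (simp add: co)
  have "{q. \<exists>n. coord g (q, n) \<noteq> \<one>} \<subseteq> {fst z | z. p g z \<noteq> z}"
  proof clarify
    fix q n assume "coord g (q, n) \<noteq> \<one>"
    then have "p g (q, n, \<one>) \<noteq> (q, n, \<one>)" by (auto simp: coord_def prod_eq_iff)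
    then show "\<exists>z. q = fst z \<and> p g z \<noteq> z" by (intro exI[of _ "(q, n, \<one>)"]) simp
  qed
  with g(3) show "finite {q. \<exists>n. coord g (q, n) \<noteq> \<one>}" by (rule rev_finite_subset)
qed

abbreviation "K2 \<equiv> G\<lparr>carrier := G2\<rparr>"
abbreviation "P2 \<equiv> product_group (UNIV :: (complex \<times> int) set) (\<lambda>_. H)"

lemma coord_mult: "g \<in> G2 \<Longrightarrow> h \<in> G2 \<Longrightarrow> coord (g \<otimes>\<^bsub>G\<^esub> h) i = coord g i \<otimes> coord h i"
proof -
  assume gh: "g \<in> G2" "h \<in> G2"
  then have "p (g \<otimes>\<^bsub>G\<^esub> h) = p g \<circ> p h" by (simp add: G2_def p_mult)
  then have "coord (g \<otimes>\<^bsub>G\<^esub> h) i = snd (snd (p g (p h (fst i, snd i, \<one>))))"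
    by (cases i) (simp add: coord_def)
  then show ?thesis
    using G2_act(1,2)[OF gh(1)] G2_act(1,2)[OF gh(2)] by (cases i) (simp add: act_simp)
qed

lemma group_hom_coord: "group_hom K2 P2 coord"
proof (intro group_hom.intro group_hom_axioms.intro)
  show "group K2" using subgroup_G2 by (rule G.subgroup_imp_group)
  show "group P2" by (rule product_group) (rule is_group)
  show "coord \<in> hom K2 P2"
    by (rule homI) (auto simp: coord_mult G2_act(2) fun_eq_iff)
qed

text \<open>The coordinates determine the permutation part and ignore the cocycle.\<close>

lemma kernel_coord: "kernel K2 P2 coord = G1"
proof -
  have "coord g = (\<lambda>_. \<one>) \<longleftrightarrow> p g = id" if "g \<in> G2" for g
  proof
    assume "coord g = (\<lambda>_. \<one>)"
    then show "p g = id" using G2_act(1)[OF that] by (simp add: act_id)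
  next
    assume "p g = id"
    then show "coord g = (\<lambda>_. \<one>)" by (auto simp: coord_def)
  qed
  then show ?thesis
    using G1_subset_G2 by (auto simp: kernel_def restrict_def G1_def G2_def)
qed

text \<open>For finitely many cosets, coordinates are trivial off finitely many \<open>q\<close>.
  Over each such \<open>q\<close> they are trivial far down and constant far up, so a finite set of
  pairs \<open>(q, n)\<close> represents all patterns.\<close>

lemma in_class_E_G2_Mod_G1: "in_class_E H (K2 Mod G1)"
proof -
  interpret c: group_hom K2 P2 coord by (rule group_hom_coord)
  \<comment> \<open>\<open>coord\<close> is constant on a coset of its kernel \<open>G1\<close>, so
    its image of \<open>X\<close> is a singleton.\<close>
  let ?\<theta> = "\<lambda>X. the_elem (coord ` X)"
  have hom: "?\<theta> \<in> hom (K2 Mod G1) P2" and inj: "inj_on ?\<theta> (carrier (K2 Mod G1))"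
    using c.FactGroup_hom c.FactGroup_inj_on by (simp_all add: kernel_coord)
  have grp: "group (K2 Mod G1)"
    using normal.factorgroup_is_group[OF c.normal_kernel] by (simp add: kernel_coord)
  have rep: "\<exists>g\<in>G2. ?\<theta> X = coord g" if X: "X \<in> carrier (K2 Mod G1)" for X
  proof -
    obtain g where g: "g \<in> G2" "X = (\<Union>k\<in>G1. {k \<otimes>\<^bsub>G\<^esub> g})"
      using X by (auto simp: FactGroup_def RCOSETS_def r_coset_def)
    have "coord (k \<otimes>\<^bsub>G\<^esub> g) = coord g" if k: "k \<in> G1" for k
    proof
      fix i
      have "k \<in> G2" "coord k i = \<one>"
        using k G1_subset_G2 by (auto simp: G1_def coord_def split: prod.split)
      then show "coord (k \<otimes>\<^bsub>G\<^esub> g) i = coord g i"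
        using coord_mult[of k g] g(1) G2_act(2)[OF g(1)] by simp
    qed
    moreover have "coord ` X = (\<lambda>k. coord (k \<otimes>\<^bsub>G\<^esub> g)) ` G1"
      unfolding g(2) by auto
    moreover have "G1 \<noteq> {}" using subgroup.one_closed[OF subgroup_G1] by auto
    ultimately have "coord ` X = {coord g}" by auto
    then show ?thesis using g(1) by auto
  qed
  show ?thesis
  proof (rule in_class_E_I[OF grp is_group, where \<theta> = "\<lambda>i X. ?\<theta> X i"])
    show "(\<lambda>X. ?\<theta> X i) \<in> hom (K2 Mod G1) H" for i
      using hom by (cases i) (auto simp: hom_def Pi_iff PiE_iff)
  next
    fix X assume X: "X \<in> carrier (K2 Mod G1)" and X1: "\<And>i. ?\<theta> X i = \<one>"
    have "?\<theta> X = \<one>\<^bsub>P2\<^esub>" by (rule ext) (simp add: X1)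
    also have "\<dots> = ?\<theta> \<one>\<^bsub>K2 Mod G1\<^esub>"
      using hom_one[OF hom grp c.H.is_group] by simp
    finally show "X = \<one>\<^bsub>K2 Mod G1\<^esub>"
      by (rule inj_onD[OF inj _ X monoid.one_closed[OF group.is_monoid[OF grp]]])
  next
    fix T assume T: "finite T" "T \<subseteq> carrier (K2 Mod G1)"
    then have "\<forall>X\<in>T. \<exists>g\<in>G2. ?\<theta> X = coord g" using rep by blast
    then obtain g where g: "\<And>X. X \<in> T \<Longrightarrow> g X \<in> G2" "\<And>X. X \<in> T \<Longrightarrow> ?\<theta> X = coord (g X)"
      by metis
    define E where "E = (\<Union>X\<in>T. {q. \<exists>n. coord (g X) (q, n) \<noteq> \<one>})"
    have E: "finite E" unfolding E_def using T(1) g(1) G2_act(4) by blast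
    have "\<forall>X\<in>T. \<forall>q. \<exists>N. \<exists>y. \<forall>n. (N \<le> n \<longrightarrow> coord (g X) (q, n) = y) \<and> (n \<le> - N \<longrightarrow> coord (g X) (q, n) = \<one>)"
      using G2_act(3)[OF g(1)] unfolding ev_const_def by blast
    then obtain N where N: "\<And>X q. X \<in> T \<Longrightarrow> \<exists>y. \<forall>n. (N X q \<le> n \<longrightarrow> coord (g X) (q, n) = y) \<and>
        (n \<le> - N X q \<longrightarrow> coord (g X) (q, n) = \<one>)"
      by metis
    \<comment> \<open>The sum bounds all thresholds over \<open>q\<close> at once and is nonnegative
      even when \<open>T\<close> is empty.\<close>
    define M where "M q = (\<Sum>X\<in>T. \<bar>N X q\<bar>)" for q
    have M: "N X q \<le> M q" if "X \<in> T" for X q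
    proof -
      have "\<bar>N X q\<bar> \<le> M q" unfolding M_def using that T(1) by (intro member_le_sum) auto
      then show ?thesis by linarith
    qed
    \<comment> \<open>The endpoint \<open>(q, M q)\<close> stands for all higher levels over
      \<open>q\<close>.\<close>
    define J where "J = (SIGMA q:E. {- M q..M q})"
    have "finite J" unfolding J_def using E by blast
    moreover have "(\<forall>X\<in>T. ?\<theta> X i = \<one>) \<or> (\<exists>j\<in>J. \<forall>X\<in>T. ?\<theta> X i = ?\<theta> X j)" for i
    proof -
      obtain q n where i: "i = (q, n)" by (cases i)
      consider "q \<notin> E" | "q \<in> E" "n \<le> - M q" | "q \<in> E" "- M q \<le> n" "n \<le> M q" | "q \<in> E" "- M q \<le> n" "M q < n"
        by linarith
      then show ?thesis
      proof cases
        case 1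
        then show ?thesis using g(2) by (auto simp: i E_def)
      next
        case 2
        have "coord (g X) (q, n) = \<one>" if "X \<in> T" for X
          using N[OF that, of q] M[OF that, of q] 2(2) by force
        then show ?thesis using g(2) by (simp add: i)
      next
        case 3
        then have "i \<in> J" by (simp add: i J_def)
        then show ?thesis by blast
      next
        case 4
        have "0 \<le> M q" by (simp add: M_def sum_nonneg)
        then have "(q, M q) \<in> J" using 4 by (simp add: J_def)
        moreover have "coord (g X) (q, n) = coord (g X) (q, M q)" if "X \<in> T" for X
          using N[OF that, of q] M[OF that, of q] 4(3) by force
        ultimately show ?thesis using g(2) unfolding i by (intro disjI2 bexI[of _ "(q, M q)"]) auto
      qed
    qed
    ultimately show "\<exists>J. finite J \<and> (\<forall>i. (\<forall>X\<in>T. ?\<theta> X i = \<one>) \<or> (\<exists>j\<in>J. \<forall>X\<in>T. ?\<theta> X i = ?\<theta> X j))"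
      by blast
  qed
qed

end

section \<open>The embedding theorem\<close>

text \<open>Elements of length \<open>n\<close> receive numbers in the dyadic interval from
  \<open>2 ^ (C * n)\<close> to \<open>2 ^ (C * n + 1)\<close>, which has room for the whole
  sphere.\<close>

lemma exponential_numbering:
  assumes "length_function H l" "growth_at_most_exponential H l" "group H"
  obtains \<nu> :: "'a \<Rightarrow> nat" and B :: nat
  where "inj_on \<nu> (carrier H)" "\<And>h. h \<in> carrier H \<Longrightarrow> \<nu> h < 2 ^ (B * l h + 1)"
proof -
  interpret group H by fact
  obtain a :: real where a: "\<And>n. n \<ge> 1 \<Longrightarrow> finite {h \<in> carrier H. l h \<le> n}"
    "\<And>n. n \<ge> 1 \<Longrightarrow> real (card {h \<in> carrier H. l h \<le> n}) \<le> a ^ n"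
    using assms(2) unfolding growth_at_most_exponential_def by blast
  obtain B where B: "a < 2 ^ B" using real_arch_pow[of 2 a] by auto
  \<comment> \<open>The successor ensures \<open>C \<ge> 1\<close>, so that the intervals for
    different lengths are disjoint.\<close>
  define C where "C = Suc B"
  have "a \<ge> 0" using a(2)[of 1] by (simp add: order_trans[OF of_nat_0_le_iff])
  have aC: "a \<le> 2 ^ C" using B \<open>a \<ge> 0\<close> by (simp add: C_def)
  define S where "S n = {h \<in> carrier H. l h = n}" for n
  have S: "finite (S n) \<and> card (S n) \<le> 2 ^ (C * n)" for n
  \<comment> \<open>The growth bound starts at \<open>n = 1\<close>; the sphere of radius 0 contains
    only the identity.\<close>
  proof (cases "n = 0")
    case True
    have "S 0 \<subseteq> {\<one>\<^bsub>H\<^esub>}" using assms(1) by (auto simp: S_def length_function_def)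
    then show ?thesis using True card_mono[of "{\<one>\<^bsub>H\<^esub>}" "S 0"] by (auto intro: finite_subset)
  next
    case False
    then have n: "n \<ge> 1" by simp
    have sub: "S n \<subseteq> {h \<in> carrier H. l h \<le> n}" by (auto simp: S_def)
    have "real (card (S n)) \<le> real (card {h \<in> carrier H. l h \<le> n})"
      using card_mono[OF a(1)[OF n] sub] by simp
    also have "\<dots> \<le> a ^ n" by (rule a(2)[OF n])
    also have "\<dots> \<le> (2 ^ C) ^ n" using aC \<open>a \<ge> 0\<close> by (rule power_mono)
    also have "\<dots> = real (2 ^ (C * n))" by (simp add: power_mult)
    finally show ?thesis using finite_subset[OF sub a(1)[OF n]] by (simp only: of_nat_le_iff)
  qed
  have "\<exists>e. inj_on e (S n) \<and> e ` S n \<subseteq> {..<2 ^ (C * n) :: nat}" for n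
    using S[of n] by (metis card_le_inj card_lessThan finite_lessThan)
  then obtain e where e: "\<And>n. inj_on (e n) (S n)" "\<And>n. e n ` S n \<subseteq> {..<2 ^ (C * n) :: nat}"
    by metis
  define \<nu> where "\<nu> h = 2 ^ (C * l h) + e (l h) h" for h
  have lo: "2 ^ (C * l h) \<le> \<nu> h" for h by (simp add: \<nu>_def)
  have hi: "\<nu> h < 2 ^ (C * l h + 1)" if "h \<in> carrier H" for h
    using e(2)[of "l h"] that by (auto simp: \<nu>_def S_def)
  have "l h \<le> l k" if "h \<in> carrier H" "k \<in> carrier H" "\<nu> h = \<nu> k" for h k
  proof (rule ccontr)
    assume "\<not> l h \<le> l k"
    then have "C * Suc (l k) \<le> C * l h" by (intro mult_le_mono2) simp
    then have "C * l k + 1 \<le> C * l h" by (simp add: C_def)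
    then have "(2::nat) ^ (C * l k + 1) \<le> 2 ^ (C * l h)" by (intro power_increasing) auto
    with lo[of h] hi[OF that(2)] that(3) show False by linarith
  qed
  then have same: "l h = l k" if "h \<in> carrier H" "k \<in> carrier H" "\<nu> h = \<nu> k" for h k
    using that by (metis le_antisym)
  have "inj_on \<nu> (carrier H)"
  proof (rule inj_onI)
    fix h k assume hk: "h \<in> carrier H" "k \<in> carrier H" "\<nu> h = \<nu> k"
    then have "e (l h) h = e (l h) k" using same[OF hk] by (simp add: \<nu>_def)
    then show "h = k" using inj_onD[OF e(1)[of "l h"]] hk same[OF hk] by (simp add: S_def)
  qed
  then show ?thesis using hi that by blast
qed

theorem theorem1p1:
  fixes H :: "('a, 'b) monoid_scheme" and l :: "'a \<Rightarrow> nat"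
  assumes "group H"
    and "length_function H l"
    and "growth_at_most_exponential H l"
  shows "\<exists>(G :: nat monoid) S \<iota>.
    group G \<and> finite S \<and> S \<subseteq> carrier G \<and> generate G S = carrier G \<and>
    \<iota> \<in> mon H G \<and>
    (\<exists>c::real. c > 0 \<and>
       (\<forall>h\<in>carrier H. c * real (word_length G S (\<iota> h)) \<le> real (l h) \<and>
                        l h \<le> word_length G S (\<iota> h))) \<and>
    (\<exists>G1 G2. G1 \<lhd> G \<and> G2 \<lhd> G \<and> G1 \<subseteq> G2 \<and>
       comm_group (G\<lparr>carrier := G1\<rparr>) \<and>
       G1 \<inter> \<iota> ` carrier H = {\<one>\<^bsub>G\<^esub>} \<and>
       in_class_E H (G\<lparr>carrier := G2\<rparr> Mod G1) \<and>
       solvable (G Mod G2) \<and> derived_length (G Mod G2) \<le> 3)"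
proof -
  obtain \<nu> :: "'a \<Rightarrow> nat" and B :: nat where \<nu>: "inj_on \<nu> (carrier H)"
    "\<And>h. h \<in> carrier H \<Longrightarrow> \<nu> h < 2 ^ (B * l h + 1)"
    using exponential_numbering[OF assms(2,3,1)] by blast
  interpret weighted_group H l \<nu>
    by (intro weighted_group.intro weighted_group_axioms.intro assms \<nu>)
  let ?W = "cocycle_group :: ((complex \<times> int \<times> 'a \<Rightarrow> complex \<times> int \<times> 'a) \<times> (complex \<times> int \<times> 'a \<Rightarrow> real)) monoid"
  define C where "C = generate ?W gens"
  have sub: "subgroup C ?W" unfolding C_def by (rule cocycle.generate_is_subgroup[OF gens_carrier])
  have gens_C: "gens \<subseteq> C" unfolding C_def by (auto intro: generate.incl)
  have fin: "finite gens" by (simp add: gens_def)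
  let ?C = "?W\<lparr>carrier := C\<rparr>"
  interpret C: group ?C using sub by (rule cocycle.subgroup_imp_group)
  have "countable (carrier ?C)"
    unfolding C_def using cocycle.countable_generate[OF gens_carrier fin] by simp
  \<comment> \<open>The finitely generated subgroup \<open>C\<close> is countable and is copied to
    \<open>nat\<close>; \<open>\<rho>\<close> below is the inverse of the copying map.\<close>
  then obtain G :: "nat monoid" and e where G: "group G" and e: "e \<in> iso ?C G"
    by (rule C.countable_group_nat_copy)
  interpret G: group G by fact
  define \<rho> where "\<rho> = inv_into C e"
  have e_hom: "e \<in> hom ?C G" and e_bij: "bij_betw e C (carrier G)"
    using e by (auto simp: iso_def)
  have \<rho>_e: "\<rho> (e x) = x" if "x \<in> C" for x
    using that e_bij by (simp add: \<rho>_def bij_betw_inv_into_left)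
  have "\<rho> \<in> iso G ?C" using C.iso_set_sym[OF e] by (simp add: \<rho>_def)
  then have "\<rho> \<in> hom G ?C" and \<rho>_bij: "bij_betw \<rho> (carrier G) C" by (auto simp: iso_def)
  then have \<rho>_hom: "\<rho> \<in> hom G ?W" using subgroup.subset[OF sub] by (auto simp: hom_def Pi_iff)
  interpret realization H l \<nu> G \<rho>
    using \<rho>_hom \<rho>_bij
    by (intro realization.intro realization_axioms.intro weighted_group_axioms G)
       (auto simp: bij_betw_def C_def)
  interpret e: group_hom ?C G e by (intro group_hom.intro group_hom_axioms.intro C.is_group G e_hom)
  interpret \<rho>: group_hom G ?W \<rho>
    by (intro group_hom.intro group_hom_axioms.intro cocycle.is_group G \<rho>_hom)
  define S where "S = e ` gens"
  define \<iota> where "\<iota> h = e (emb h)" for h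
  \<comment> \<open>For \<open>l h \<ge> 1\<close> the additive constants are absorbed into the
    factor of \<open>l h\<close>. At the identity the radius is 0, so that case is separate.\<close>
  have ball: "in_ball ?W gens ((48 * B + 60) * l h) (emb h)" if h: "h \<in> carrier H" for h
  proof (cases "h = \<one>\<^bsub>H\<^esub>")
    case True
    then have "emb h \<otimes>\<^bsub>?W\<^esub> emb h = emb h" using emb_mult[OF h h] by simp
    then have "emb h = \<one>\<^bsub>?W\<^esub>" using emb_carrier[OF h] by (metis cocycle.l_cancel_one)
    then show ?thesis using cocycle.in_ball_one in_ball_mono by fastforce
  next
    case False
    then have "1 \<le> l h" using l_eq_0[OF h] by simp
    have "(\<nu> h)\<^sup>2 < (2 ^ (B * l h + 1))\<^sup>2" using \<nu>(2)[OF h] by (intro power_strict_mono) auto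
    also have "\<dots> = 2 ^ (2 * (B * l h + 1))" by (simp add: power_mult[symmetric] mult.commute)
    finally have "in_ball ?W gens (12 * (2 * (B * l h + 1)) + 2 * l h + 4) (emb h)"
      by (rule emb_in_ball[OF h])
    then show ?thesis
      by (rule in_ball_mono) (use \<open>1 \<le> l h\<close> in \<open>simp add: algebra_simps\<close>)
  qed
  have emb_C: "emb h \<in> C" if "h \<in> carrier H" for h
    using cocycle.in_ball_imp_generate[OF gens_carrier ball[OF that]] by (simp add: C_def)
  have S: "S \<subseteq> carrier G" using gens_C e_bij by (auto simp: S_def bij_betw_def)
  have "generate G S = e ` generate ?C gens"
    unfolding S_def using e.generate_img gens_C by simp
  also have "generate ?C gens = C"
    using cocycle.generate_consistent[OF gens_C sub] by (simp add: C_def)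
  finally have gen: "generate G S = carrier G" using e_bij by (simp add: bij_betw_def)
  have \<iota>: "\<iota> \<in> mon H G"
    unfolding mon_def
  proof (intro CollectI conjI homI inj_onI)
    fix h k assume hk: "h \<in> carrier H" "k \<in> carrier H"
    show "\<iota> (h \<otimes>\<^bsub>H\<^esub> k) = \<iota> h \<otimes>\<^bsub>G\<^esub> \<iota> k"
      using e.hom_mult[of "emb h" "emb k"] emb_C hk by (simp add: \<iota>_def emb_mult)
    assume "\<iota> h = \<iota> k"
    then have "emb h = emb k" using \<rho>_e emb_C hk by (metis \<iota>_def)
    \<comment> \<open>The permutation part of \<open>emb h\<close> sends this point to
      \<open>(0, 0, h)\<close>, so it reveals \<open>h\<close>.\<close>
    then have "fst (emb h) (0, 0, \<one>\<^bsub>H\<^esub>) = fst (emb k) (0, 0, \<one>\<^bsub>H\<^esub>)" by simp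
    then show "h = k" using hk by (simp add: emb_def act_simp)
  qed (use emb_C e_bij in \<open>auto simp: \<iota>_def bij_betw_def\<close>)
  have upper: "word_length G S (\<iota> h) \<le> (48 * B + 60) * l h" if h: "h \<in> carrier H" for h
  proof (rule word_length_le)
    have "in_ball ?C gens ((48 * B + 60) * l h) (emb h)"
      using cocycle.in_ball_subgroup[OF sub gens_C ball[OF h]] .
    then show "in_ball G S ((48 * B + 60) * l h) (\<iota> h)"
      unfolding S_def \<iota>_def using in_ball_hom[OF e.group_hom_axioms] gens_C by simp
  qed
  have lower: "l h \<le> word_length G S (\<iota> h)" if h: "h \<in> carrier H" for h
  proof -
    have "\<iota> h \<in> generate G S" using gen \<iota> h by (auto simp: mon_def hom_def)
    then obtain n where "in_ball G S n (\<iota> h)" using G.generate_imp_in_ball[OF S] by blast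
    \<comment> \<open>\<open>\<rho>\<close> turns a shortest word over \<open>S\<close> into a word
      over \<open>gens\<close> of the same length, to which the cocycle bound applies.\<close>
    then have "in_ball G S (word_length G S (\<iota> h)) (\<iota> h)" by (rule in_ball_word_length)
    then have "in_ball ?W (\<rho> ` S) (word_length G S (\<iota> h)) (\<rho> (\<iota> h))"
      using in_ball_hom[OF \<rho>.group_hom_axioms S] by simp
    moreover have "\<rho> ` S = gens" using gens_C \<rho>_e by (force simp: S_def image_image)
    moreover have "\<rho> (\<iota> h) = emb h" using \<rho>_e emb_C[OF h] by (simp add: \<iota>_def)
    ultimately have *: "in_ball ?W gens (word_length G S (\<iota> h)) (emb h)" by simp
    show ?thesis using emb_lower_bound[OF h *] word_length_le[OF *] by linarith
  qed
  have "G1 \<inter> \<iota> ` carrier H = {\<one>\<^bsub>G\<^esub>}"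
  proof
    show "G1 \<inter> \<iota> ` carrier H \<subseteq> {\<one>\<^bsub>G\<^esub>}"
    proof clarify
      fix h assume h: "h \<in> carrier H" "\<iota> h \<in> G1"
      then have "fst (emb h) = id" using \<rho>_e emb_C by (simp add: G1_def \<iota>_def)
      then have "fst (emb h) (0, 0, \<one>\<^bsub>H\<^esub>) = (0, 0, \<one>\<^bsub>H\<^esub>)" by simp
      then have "h = \<one>\<^bsub>H\<^esub>" using h by (simp add: emb_def act_simp)
      then show "\<iota> h = \<one>\<^bsub>G\<^esub>"
        using \<iota> hom_one[OF _ assms(1) G] by (simp add: mon_def)
    qed
    have "\<iota> \<one>\<^bsub>H\<^esub> = \<one>\<^bsub>G\<^esub>" using \<iota> hom_one[OF _ assms(1) G] by (simp add: mon_def)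
    then show "{\<one>\<^bsub>G\<^esub>} \<subseteq> G1 \<inter> \<iota> ` carrier H"
      using subgroup.one_closed[OF subgroup_G1] one_closed by (metis IntI empty_subsetI image_eqI insert_subset)
  qed
  moreover have "solvable (G Mod G2)" "derived_length (G Mod G2) \<le> 3"
    using normal.solvable_Mod[OF normal_G2 derived_G] by blast+
  moreover define c :: real where "c = 1 / real (48 * B + 60)"
  moreover have "c * real (word_length G S (\<iota> h)) \<le> real (l h) \<and> l h \<le> word_length G S (\<iota> h)"
    if "h \<in> carrier H" for h
  proof
    have "real (word_length G S (\<iota> h)) \<le> real ((48 * B + 60) * l h)"
      using upper[OF that] by (simp only: of_nat_le_iff)
    then show "c * real (word_length G S (\<iota> h)) \<le> real (l h)"
      by (simp add: c_def divide_le_eq mult.commute)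
  qed (rule lower[OF that])
  moreover have "c > 0" by (simp add: c_def)
  moreover have "finite S" using fin by (simp add: S_def)
  ultimately show ?thesis
    using G S gen \<iota> normal_G1 normal_G2 G1_subset_G2 comm_group_G1 in_class_E_G2_Mod_G1
    by (intro exI[of _ G] exI[of _ S] exI[of _ \<iota>] conjI exI[of _ c] exI[of _ G1] exI[of _ G2] ballI) simp_all
qed

end
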